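(* Let $S$ be a density operator on $L^2(\mathbb{R}^d)$, and let $f\in L^1(\mathbb{R}^{2d})$ be a positive function such that $\int_{\mathbb{R}^{2d}}f(z)\,dz=1$. Then $f\star S$ is a density operator.
   Context: Fix $d\ge 1$. For $z=(x,\omega)\in\mathbb{R}^{2d}$ let $\pi(z)\psi(t)=e^{2\pi i\omega\cdot t}\psi(t-x)$ on $L^2(\mathbb{R}^d)$, and for a bounded operator $A$ on $L^2(\mathbb{R}^d)$ let $\alpha_z(A)=\pi(z)A\pi(z)^*$. For $f\in L^1(\mathbb{R}^{2d})$ and a trace class operator $S$, the operator $f\star S=\int_{\mathbb{R}^{2d}}f(z)\alpha_z(S)\,dz$ is defined weakly by $\langle(f\star S)\psi,\xi\rangle=\int_{\mathbb{R}^{2d}}f(z)\langle\alpha_z(S)\psi,\xi\rangle\,dz$ for $\psi,\xi\in L^2(\mathbb{R}^d)$. A density operator is a positive trace class operator with trace $1$. "Positive function" means nonnegative. *)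

theory Defs
  imports "HOL-Analysis.Analysis"
begin

section \<open>The complex Hilbert space of square-integrable functions modulo null sets\<close>

definition square_integrable :: "('a::euclidean_space \<Rightarrow> complex) \<Rightarrow> bool" where
  "square_integrable f \<longleftrightarrow>
     f \<in> borel_measurable lebesgue \<and> integrable lebesgue (\<lambda>t. (norm (f t))\<^sup>2)"

definition L2_rel :: "('a::euclidean_space \<Rightarrow> complex) \<Rightarrow> ('a \<Rightarrow> complex) \<Rightarrow> bool" where
  "L2_rel f g \<longleftrightarrow> square_integrable f \<and> square_integrable g \<and> (AE t in lebesgue. f t = g t)"

lemma square_integrable_zero: "square_integrable (\<lambda>_. 0)"
  by (simp add: square_integrable_def)

lemma square_integrable_add:
  assumes "square_integrable f" "square_integrable g"
  shows "square_integrable (\<lambda>t. f t + g t)"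
proof -
  note [measurable] = assms[unfolded square_integrable_def, THEN conjunct1]
  have "integrable lebesgue (\<lambda>t. 2 * (norm (f t))\<^sup>2 + 2 * (norm (g t))\<^sup>2)"
    using assms by (simp add: square_integrable_def)
  then have "integrable lebesgue (\<lambda>t. (norm (f t + g t))\<^sup>2)"
  proof (rule Bochner_Integration.integrable_bound)
    show "AE t in lebesgue. norm ((norm (f t + g t))\<^sup>2)
            \<le> norm (2 * (norm (f t))\<^sup>2 + 2 * (norm (g t))\<^sup>2)"
    proof (rule AE_I2)
      fix t
      have "(norm (f t + g t))\<^sup>2 \<le> (norm (f t) + norm (g t))\<^sup>2"
        by (intro power_mono norm_triangle_ineq) auto
      also have "\<dots> \<le> 2 * (norm (f t))\<^sup>2 + 2 * (norm (g t))\<^sup>2"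
        using zero_le_power2[of "norm (f t) - norm (g t)"]
        by (simp add: power2_eq_square algebra_simps)
      finally show "norm ((norm (f t + g t))\<^sup>2)
                      \<le> norm (2 * (norm (f t))\<^sup>2 + 2 * (norm (g t))\<^sup>2)"
        by simp
    qed
  qed measurable
  then show ?thesis
    by (simp add: square_integrable_def)
qed

lemma square_integrable_mult:
  assumes "square_integrable f"
  shows "square_integrable (\<lambda>t. c * f t)"
  using assms by (auto simp: square_integrable_def norm_mult power_mult_distrib)

lemma integrable_mult_cnj:
  assumes "square_integrable f" "square_integrable g"
  shows "integrable lebesgue (\<lambda>t. f t * cnj (g t))"
proof -
  note [measurable] = assms[unfolded square_integrable_def, THEN conjunct1]
  have [measurable]: "(\<lambda>t. cnj (g t)) \<in> borel_measurable lebesgue"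
    by (rule measurable_compose[OF _ borel_measurable_continuous_onI])
       (auto intro!: continuous_intros assms(2)[unfolded square_integrable_def, THEN conjunct1])
  have "integrable lebesgue (\<lambda>t. (norm (f t))\<^sup>2 + (norm (g t))\<^sup>2)"
    using assms by (simp add: square_integrable_def)
  then show ?thesis
  proof (rule Bochner_Integration.integrable_bound)
    show "AE t in lebesgue. norm (f t * cnj (g t)) \<le> norm ((norm (f t))\<^sup>2 + (norm (g t))\<^sup>2)"
    proof (rule AE_I2)
      fix t
      have "0 \<le> norm (f t) * norm (g t)"
        by simp
      with zero_le_power2[of "norm (f t) - norm (g t)"]
      have "norm (f t) * norm (g t) \<le> (norm (f t))\<^sup>2 + (norm (g t))\<^sup>2"
        unfolding power2_eq_square by (simp only: algebra_simps)
      then show "norm (f t * cnj (g t)) \<le> norm ((norm (f t))\<^sup>2 + (norm (g t))\<^sup>2)"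
        by (simp add: norm_mult)
    qed
  qed measurable
qed

lemma distr_lebesgue_translation:
  "distr lebesgue lebesgue (\<lambda>t. t - x) = (lebesgue :: 'a::euclidean_space measure)"
proof -
  have T: "(\<lambda>t. - x + (\<Sum>j\<in>Basis. (1 * (t \<bullet> j)) *\<^sub>R j)) = (\<lambda>t::'a. t - x)"
    by (simp add: euclidean_representation)
  show ?thesis
    using lebesgue_affine_euclidean[of "\<lambda>_. 1" "- x :: 'a", unfolded T]
    by (simp add: density_1)
qed

lemma measurable_lebesgue_translation:
  "(\<lambda>t. t - x) \<in> lebesgue \<rightarrow>\<^sub>M (lebesgue :: 'a::euclidean_space measure)"
proof -
  have T: "(\<lambda>t. - x + (\<Sum>j\<in>Basis. (1 * (t \<bullet> j)) *\<^sub>R j)) = (\<lambda>t::'a. t - x)"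
    by (simp add: euclidean_representation)
  show ?thesis
    using lebesgue_affine_measurable[of "\<lambda>_. 1" "- x :: 'a", unfolded T] by simp
qed

lemma square_integrable_shift:
  fixes f :: "'a::euclidean_space \<Rightarrow> complex"
  assumes "square_integrable f"
  shows "square_integrable (\<lambda>t. cis (2 * pi * (\<omega> \<bullet> t)) * f (t - x))"
proof -
  have f: "f \<in> borel_measurable lebesgue" "integrable lebesgue (\<lambda>t. (norm (f t))\<^sup>2)"
    using assms by (auto simp: square_integrable_def)
  have fx: "(\<lambda>t. f (t - x)) \<in> borel_measurable lebesgue"
    using measurable_compose[OF measurable_lebesgue_translation f(1)] .
  have "continuous_on UNIV (\<lambda>t::'a. cis (2 * pi * (\<omega> \<bullet> t)))"
    by (intro continuous_intros)
  then have "(\<lambda>t::'a. cis (2 * pi * (\<omega> \<bullet> t))) \<in> borel_measurable lebesgue"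
    by (intro measurable_completion) (simp add: borel_measurable_continuous_onI)
  moreover have "integrable lebesgue (\<lambda>t. (norm (f (t - x)))\<^sup>2)"
    using f(2) integrable_distr[OF measurable_lebesgue_translation[of x], of "\<lambda>t. (norm (f t))\<^sup>2"]
    by (simp add: distr_lebesgue_translation)
  ultimately show ?thesis
    using fx by (auto simp: square_integrable_def norm_mult)
qed

lemma AE_shift:
  fixes f g :: "'a::euclidean_space \<Rightarrow> complex"
  assumes "AE t in lebesgue. f t = g t"
  shows "AE t in lebesgue. f (t - x) = g (t - x)"
proof -
  have "AE t in distr lebesgue lebesgue (\<lambda>t. t - x). f t = g t"
    unfolding distr_lebesgue_translation by (rule assms)
  then show ?thesis
    by (rule AE_distrD[OF measurable_lebesgue_translation])
qed

quotient_type (overloaded) 'a L2 = "'a::euclidean_space \<Rightarrow> complex" / partial: L2_rel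
proof (rule part_equivpI)
  show "\<exists>f. L2_rel f f"
    by (rule exI[of _ "\<lambda>_. 0"]) (simp add: L2_rel_def square_integrable_zero)
qed (auto simp: L2_rel_def intro!: sympI transpI elim: AE_mp)

lift_definition cinner :: "'a::euclidean_space L2 \<Rightarrow> 'a L2 \<Rightarrow> complex"
  is "\<lambda>f g. \<integral>t. f t * cnj (g t) \<partial>lebesgue"
  by (rule integral_cong_AE)
     (auto simp: L2_rel_def intro: borel_measurable_integrable integrable_mult_cnj)

lift_definition scaleC :: "complex \<Rightarrow> 'a::euclidean_space L2 \<Rightarrow> 'a L2"
  is "\<lambda>c f t. c * f t"
  by (auto simp: L2_rel_def intro: square_integrable_mult)

instantiation L2 :: (euclidean_space) real_inner
begin

lift_definition zero_L2 :: "'a L2" is "\<lambda>_. 0"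
  by (simp add: L2_rel_def square_integrable_zero)

lift_definition plus_L2 :: "'a L2 \<Rightarrow> 'a L2 \<Rightarrow> 'a L2" is "\<lambda>f g t. f t + g t"
  by (auto simp: L2_rel_def intro: square_integrable_add)

definition uminus_L2 :: "'a L2 \<Rightarrow> 'a L2" where "- x = scaleC (- 1) x"

definition minus_L2 :: "'a L2 \<Rightarrow> 'a L2 \<Rightarrow> 'a L2" where "x - y = x + - (y :: 'a L2)"

definition scaleR_L2 :: "real \<Rightarrow> 'a L2 \<Rightarrow> 'a L2" where "r *\<^sub>R x = scaleC (of_real r) x"

definition inner_L2 :: "'a L2 \<Rightarrow> 'a L2 \<Rightarrow> real" where "inner x y = Re (cinner x y)"

definition norm_L2 :: "'a L2 \<Rightarrow> real" where "norm x = sqrt (inner x (x :: 'a L2))"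

definition dist_L2 :: "'a L2 \<Rightarrow> 'a L2 \<Rightarrow> real" where "dist x y = norm (x - y :: 'a L2)"

definition sgn_L2 :: "'a L2 \<Rightarrow> 'a L2" where "sgn x = inverse (norm x) *\<^sub>R (x :: 'a L2)"

definition uniformity_L2 :: "('a L2 \<times> 'a L2) filter" where
  "uniformity_L2 = (INF e\<in>{0<..}. principal {(x, y). dist x (y :: 'a L2) < e})"

definition open_L2 :: "'a L2 set \<Rightarrow> bool" where
  "open_L2 U \<longleftrightarrow> (\<forall>x\<in>U. eventually (\<lambda>(x', y). x' = x \<longrightarrow> y \<in> U) uniformity)"

instance
proof
  fix x y z :: "'a L2" and r s :: real
  show "x + y + z = x + (y + z)"
    by transfer (auto simp: L2_rel_def add.assoc intro!: square_integrable_add)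
  show "x + y = y + x"
    by transfer (auto simp: L2_rel_def add.commute intro!: square_integrable_add)
  show "0 + x = x"
    by transfer (auto simp: L2_rel_def)
  show "- x + x = 0"
    unfolding uminus_L2_def
    by transfer (auto simp: L2_rel_def square_integrable_zero)
  show "x - y = x + - y"
    by (rule minus_L2_def)
  show "r *\<^sub>R (x + y) = r *\<^sub>R x + r *\<^sub>R y"
    unfolding scaleR_L2_def
    by transfer
       (auto simp: L2_rel_def distrib_left intro!: square_integrable_add square_integrable_mult)
  show "(r + s) *\<^sub>R x = r *\<^sub>R x + s *\<^sub>R x"
    unfolding scaleR_L2_def
    by transfer
       (auto simp: L2_rel_def distrib_right intro!: square_integrable_add square_integrable_mult)
  show "r *\<^sub>R s *\<^sub>R x = (r * s) *\<^sub>R x"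
    unfolding scaleR_L2_def
    by transfer (auto simp: L2_rel_def mult.assoc intro!: square_integrable_mult)
  show "1 *\<^sub>R x = x"
    unfolding scaleR_L2_def by transfer (auto simp: L2_rel_def)
  show "sgn x = inverse (norm x) *\<^sub>R x"
    by (rule sgn_L2_def)
  show "dist x y = norm (x - y)"
    by (rule dist_L2_def)
  show "(uniformity :: ('a L2 \<times> 'a L2) filter)
          = (INF e\<in>{0<..}. principal {(x, y). dist x y < e})"
    by (rule uniformity_L2_def)
  show "open U \<longleftrightarrow> (\<forall>x\<in>U. eventually (\<lambda>(x', y). x' = x \<longrightarrow> y \<in> U) uniformity)"
    for U :: "'a L2 set"
    by (rule open_L2_def)
  show "inner x y = inner y x"
    unfolding inner_L2_def
  proof transfer
    fix f g :: "'a \<Rightarrow> complex"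
    assume "L2_rel f f" "L2_rel g g"
    have "(\<integral>t. g t * cnj (f t) \<partial>lebesgue) = cnj (\<integral>t. f t * cnj (g t) \<partial>lebesgue)"
      by (subst Bochner_Integration.integral_cnj[symmetric]) (simp add: mult.commute)
    then show "Re (\<integral>t. f t * cnj (g t) \<partial>lebesgue) = Re (\<integral>t. g t * cnj (f t) \<partial>lebesgue)"
      by simp
  qed
  show "inner (x + y) z = inner x z + inner y z"
    unfolding inner_L2_def
    by transfer (simp add: L2_rel_def distrib_right integrable_mult_cnj)
  show "inner (r *\<^sub>R x) y = r * inner x y"
    unfolding inner_L2_def scaleR_L2_def
    by transfer (simp add: mult.assoc)
  have inner_self: "Re (\<integral>t. f t * cnj (f t) \<partial>lebesgue) = (\<integral>t. (norm (f t))\<^sup>2 \<partial>lebesgue)"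
    for f :: "'a \<Rightarrow> complex"
  proof -
    have "(\<integral>t. f t * cnj (f t) \<partial>lebesgue) = (\<integral>t. complex_of_real ((norm (f t))\<^sup>2) \<partial>lebesgue)"
      by (simp only: complex_norm_square)
    then show ?thesis
      by (simp only: integral_complex_of_real Re_complex_of_real)
  qed
  show "0 \<le> inner x x"
    unfolding inner_L2_def by transfer (simp only: inner_self, simp)
  show "inner x x = 0 \<longleftrightarrow> x = 0"
    unfolding inner_L2_def
  proof transfer
    fix f :: "'a \<Rightarrow> complex"
    assume "L2_rel f f"
    then have f: "square_integrable f"
      by (simp add: L2_rel_def)
    then have "(\<integral>t. (norm (f t))\<^sup>2 \<partial>lebesgue) = 0 \<longleftrightarrow> (AE t in lebesgue. (norm (f t))\<^sup>2 = 0)"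
      by (intro integral_nonneg_eq_0_iff_AE) (auto simp: square_integrable_def)
    then show "Re (\<integral>t. f t * cnj (f t) \<partial>lebesgue) = 0 \<longleftrightarrow> L2_rel f (\<lambda>_. 0)"
      using f by (simp add: inner_self L2_rel_def square_integrable_zero)
  qed
  show "norm x = sqrt (inner x x)"
    by (rule norm_L2_def)
qed

end

section \<open>Bounded, positive and trace class operators\<close>

definition bounded_op :: "('a::euclidean_space L2 \<Rightarrow> 'a L2) \<Rightarrow> bool" where
  "bounded_op A \<longleftrightarrow> bounded_linear A \<and> (\<forall>c \<psi>. A (scaleC c \<psi>) = scaleC c (A \<psi>))"

definition adj :: "('a::euclidean_space L2 \<Rightarrow> 'a L2) \<Rightarrow> 'a L2 \<Rightarrow> 'a L2" where
  "adj A = (THE B. bounded_op B \<and> (\<forall>\<psi> \<xi>. cinner (A \<psi>) \<xi> = cinner \<psi> (B \<xi>)))"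

definition positive_op :: "('a::euclidean_space L2 \<Rightarrow> 'a L2) \<Rightarrow> bool" where
  "positive_op A \<longleftrightarrow> bounded_op A \<and> (\<forall>\<psi>. cinner (A \<psi>) \<psi> \<in> \<real>\<^sub>\<ge>\<^sub>0)"

text \<open>The absolute value \<open>(A\<^sup>* A)\<^sup>1\<^sup>/\<^sup>2\<close>, that is, the unique positive square root.\<close>

definition abs_op :: "('a::euclidean_space L2 \<Rightarrow> 'a L2) \<Rightarrow> 'a L2 \<Rightarrow> 'a L2" where
  "abs_op A = (THE P. positive_op P \<and> P \<circ> P = adj A \<circ> A)"

definition is_onb :: "'a::euclidean_space L2 set \<Rightarrow> bool" where
  "is_onb B \<longleftrightarrow>
     (\<forall>e\<in>B. \<forall>e'\<in>B. cinner e e' = (if e = e' then 1 else 0)) \<and>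
     (\<forall>\<psi>. (\<forall>e\<in>B. cinner \<psi> e = 0) \<longrightarrow> \<psi> = 0)"

text \<open>An arbitrary orthonormal basis; neither the trace class nor the trace depends on the
  choice.\<close>

definition onb :: "'a::euclidean_space L2 set" where
  "onb = (SOME B. is_onb B)"

definition trace_class :: "('a::euclidean_space L2 \<Rightarrow> 'a L2) \<Rightarrow> bool" where
  "trace_class A \<longleftrightarrow> bounded_op A \<and> (\<lambda>e. cinner (abs_op A e) e) summable_on onb"

definition trace_op :: "('a::euclidean_space L2 \<Rightarrow> 'a L2) \<Rightarrow> complex" where
  "trace_op A = (\<Sum>\<^sub>\<infinity>e\<in>onb. cinner (A e) e)"

definition density_operator :: "('a::euclidean_space L2 \<Rightarrow> 'a L2) \<Rightarrow> bool" where
  "density_operator S \<longleftrightarrow> positive_op S \<and> trace_class S \<and> trace_op S = 1"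

section \<open>Time-frequency shifts and convolution of a function with an operator\<close>

lift_definition tf_shift :: "'a \<times> 'a \<Rightarrow> 'a::euclidean_space L2 \<Rightarrow> 'a L2"
  is "\<lambda>(x, \<omega>) \<psi> t. cis (2 * pi * (\<omega> \<bullet> t)) * \<psi> (t - x)"
proof -
  fix z :: "'a \<times> 'a" and f g :: "'a \<Rightarrow> complex"
  assume "L2_rel f g"
  moreover obtain x \<omega> where "z = (x, \<omega>)"
    by fastforce
  ultimately show "L2_rel ((case z of (x, \<omega>) \<Rightarrow> \<lambda>\<psi> t. cis (2 * pi * (\<omega> \<bullet> t)) * \<psi> (t - x)) f)
                          ((case z of (x, \<omega>) \<Rightarrow> \<lambda>\<psi> t. cis (2 * pi * (\<omega> \<bullet> t)) * \<psi> (t - x)) g)"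
    using AE_shift[of f g x] by (auto simp: L2_rel_def square_integrable_shift)
qed

definition op_translate ::
    "'a \<times> 'a \<Rightarrow> ('a::euclidean_space L2 \<Rightarrow> 'a L2) \<Rightarrow> 'a L2 \<Rightarrow> 'a L2" where
  "op_translate z A = tf_shift z \<circ> A \<circ> adj (tf_shift z)"

text \<open>The bounded operator given by the weak integral of \<open>f(z) \<alpha>\<^sub>z(S)\<close>.\<close>

definition fun_op_conv ::
    "('a \<times> 'a \<Rightarrow> complex) \<Rightarrow> ('a::euclidean_space L2 \<Rightarrow> 'a L2) \<Rightarrow> 'a L2 \<Rightarrow> 'a L2"
    (infixr \<open>\<star>\<close> 70) where
  "f \<star> S = (THE T. bounded_op T \<and>
     (\<forall>\<psi> \<xi>. cinner (T \<psi>) \<xi> = (\<integral>z. f z * cinner (op_translate z S \<psi>) \<xi> \<partial>lebesgue)))"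

end

theory Submission
  imports Defs
begin

text \<open>
  The operator \<open>f \<star> S\<close> is an average of the translates \<open>\<alpha>\<^sub>z(S)\<close> against a probability density.
  Each translate is a unitary conjugate of \<open>S\<close>, hence positive with trace \<open>1\<close>, and a probability
  average keeps both properties: positivity because the diagonal coefficients are averaged, and the
  trace because a sum of nonnegative terms may be exchanged with the integral.

  Several facts carry this argument. The weak integral defines an operator by the Riesz
  representation theorem (\<open>Riesz_representation\<close>, \<open>bounded_op_of_sesquilinear\<close>), which rests on the
  completeness of \<open>L2\<close> and on expansions in orthonormal bases (\<open>onb_expansion\<close>).
  The integrands are measurable because the coefficients of \<open>tf_shift z\<close> are and
  orthonormal bases are countable (\<open>borel_measurable_cinner_op_translate\<close>,
  \<open>countable_orthonormal\<close>); countability also allows the exchange of sum and integral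
  (\<open>has_sum_integral_nonneg\<close>). A translate has the trace of \<open>S\<close> because the trace of a positive
  operator does not depend on the basis (\<open>trace_basis_independent\<close>). Finally, trace class is defined
  through the absolute value; a positive operator equals its absolute value because positive square
  roots are unique (\<open>positive_op_sqrt_unique\<close>).
\<close>

section \<open>Complex inner product structure\<close>

lemma cinner_commute: "cinner y x = cnj (cinner x y)"
proof transfer
  fix f g :: "'a \<Rightarrow> complex"
  show "(\<integral>t. f t * cnj (g t) \<partial>lebesgue) = cnj (\<integral>t. g t * cnj (f t) \<partial>lebesgue)"
    by (subst Bochner_Integration.integral_cnj[symmetric]) (simp add: mult.commute)
qed

lemma cinner_add_left: "cinner (x + y) z = cinner x z + cinner y z"
  by transfer (simp add: L2_rel_def distrib_right integrable_mult_cnj)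

lemma cinner_scaleC_left: "cinner (scaleC c x) y = c * cinner x y"
  by transfer (simp add: mult.assoc)

lemma cinner_add_right: "cinner z (x + y) = cinner z x + cinner z y"
  by (metis cinner_add_left cinner_commute complex_cnj_add)

lemma cinner_scaleC_right: "cinner x (scaleC c y) = cnj c * cinner x y"
  by (metis cinner_scaleC_left cinner_commute complex_cnj_mult)

lemma scaleC_add_right: "scaleC c (x + y) = scaleC c x + scaleC c y"
  by transfer (auto simp: L2_rel_def distrib_left
      intro!: square_integrable_add square_integrable_mult)

lemma scaleC_scaleC: "scaleC c (scaleC d x) = scaleC (c * d) x"
  by transfer (auto simp: L2_rel_def mult.assoc intro!: square_integrable_mult)

lemma scaleC_one: "scaleC 1 x = x"
  by transfer (auto simp: L2_rel_def)

lemma cinner_self: "cinner x x = of_real ((norm x)\<^sup>2)"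
proof -
  have "Im (cinner x x) = 0"
    using cinner_commute[of x x] by (simp add: complex_eq_iff)
  moreover have "Re (cinner x x) = (norm x)\<^sup>2"
    by (simp add: power2_norm_eq_inner inner_L2_def)
  ultimately show ?thesis
    by (simp add: complex_eq_iff)
qed

lemma norm_scaleC: "norm (scaleC c x) = cmod c * norm x"
proof -
  have "complex_of_real ((norm (scaleC c x))\<^sup>2) = of_real ((cmod c * norm x)\<^sup>2)"
    by (simp add: cinner_self[symmetric] cinner_scaleC_left cinner_scaleC_right
        power_mult_distrib complex_norm_square mult.assoc del: of_real_power)
  then have "(norm (scaleC c x))\<^sup>2 = (cmod c * norm x)\<^sup>2"
    by (simp only: of_real_eq_iff)
  then show ?thesis
    by (simp add: power2_eq_iff_nonneg)
qed

text \<open>The Cauchy--Schwarz inequality of the real inner product only bounds the real part of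
  \<open>cinner x y\<close>; rotating \<open>x\<close> by a phase makes \<open>cinner x y\<close> real and nonnegative, so that
  nothing is lost.\<close>

lemma cmod_cinner_le: "cmod (cinner x y) \<le> norm x * norm y"
proof (cases "cinner x y = 0")
  case False
  define u where "u = cnj (sgn (cinner x y))"
  have u: "cmod u = 1"
    using False by (simp add: u_def norm_sgn)
  have "u * cinner x y = of_real (cmod (cinner x y))"
    using False unfolding u_def sgn_eq
    by (simp add: complex_norm_square[symmetric] mult.commute power2_eq_square)
  then have "cmod (cinner x y) = inner (scaleC u x) y"
    by (simp add: inner_L2_def cinner_scaleC_left)
  also have "\<dots> \<le> norm (scaleC u x) * norm y"
    by (rule norm_cauchy_schwarz)
  finally show ?thesis
    by (simp add: norm_scaleC u)
qed simp

lemma bounded_bilinear_cinner: "bounded_bilinear cinner"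
proof
  fix x x' y y' :: "'a L2" and r :: real
  show "cinner (x + x') y = cinner x y + cinner x' y" by (rule cinner_add_left)
  show "cinner x (y + y') = cinner x y + cinner x y'" by (rule cinner_add_right)
  show "cinner (r *\<^sub>R x) y = r *\<^sub>R cinner x y"
    by (simp add: scaleR_L2_def cinner_scaleC_left scaleR_conv_of_real)
  show "cinner x (r *\<^sub>R y) = r *\<^sub>R cinner x y"
    by (simp add: scaleR_L2_def cinner_scaleC_right scaleR_conv_of_real)
  show "\<exists>K. \<forall>a b. cmod (cinner a b) \<le> norm (a::'a L2) * norm (b::'a L2) * K"
    by (rule exI[of _ 1]) (simp add: cmod_cinner_le)
qed

interpretation cinner: bounded_bilinear cinner
  by (rule bounded_bilinear_cinner)

lemma cinner_right_ext:
  assumes "\<And>z. cinner z x = cinner z y"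
  shows "x = y"
proof -
  have "cinner (x - y) (x - y) = 0"
    using assms[of "x - y"] by (simp add: cinner.diff_right)
  then show ?thesis by (simp add: cinner_self)
qed

lemma cinner_left_ext:
  assumes "\<And>z. cinner x z = cinner y z"
  shows "x = y"
  using assms by (metis cinner_commute cinner_right_ext)

section \<open>Completeness\<close>

lemma L2_rel_rep: "L2_rel (rep_L2 x) (rep_L2 x)"
  using Quotient_rep_reflp[OF Quotient_L2] .

lemma square_integrable_rep: "square_integrable (rep_L2 x)"
  using L2_rel_rep[of x] by (simp add: L2_rel_def)

lemma abs_rep_L2: "abs_L2 (rep_L2 x) = x"
  using Quotient_abs_rep[OF Quotient_L2] .

lemma L2_rel_refl: "square_integrable f \<Longrightarrow> L2_rel f f"
  by (simp add: L2_rel_def)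

lemma abs_L2_eqI:
  assumes "square_integrable f" "square_integrable g" "AE t in lebesgue. f t = g t"
  shows "abs_L2 f = abs_L2 g"
  by (rule Quotient_rel_abs[OF Quotient_L2]) (simp add: L2_rel_def assms)

lemma cinner_abs_L2:
  "square_integrable f \<Longrightarrow> square_integrable g \<Longrightarrow>
    cinner (abs_L2 f) (abs_L2 g) = (\<integral>t. f t * cnj (g t) \<partial>lebesgue)"
  by (intro cinner.abs_eq L2_rel_refl)

lemma abs_L2_diff:
  assumes "square_integrable f" "square_integrable g"
  shows "abs_L2 f - abs_L2 g = abs_L2 (\<lambda>t. f t - g t)"
proof -
  have "abs_L2 f - abs_L2 g = abs_L2 f + abs_L2 (\<lambda>t. (-1) * g t)"
    unfolding minus_L2_def uminus_L2_def using assms by (simp add: scaleC.abs_eq L2_rel_refl)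
  also have "\<dots> = abs_L2 (\<lambda>t. f t + (-1) * g t)"
    using assms by (intro plus_L2.abs_eq L2_rel_refl square_integrable_mult)
  finally show ?thesis by simp
qed

lemma square_integrable_diff:
  assumes "square_integrable f" "square_integrable g"
  shows "square_integrable (\<lambda>t. f t - g t)"
  using square_integrable_add[OF assms(1) square_integrable_mult[OF assms(2), of "-1"]] by simp

lemma norm_abs_L2:
  assumes "square_integrable f"
  shows "(norm (abs_L2 f))\<^sup>2 = (\<integral>t. (norm (f t))\<^sup>2 \<partial>lebesgue)"
proof -
  have "complex_of_real ((norm (abs_L2 f))\<^sup>2) = (\<integral>t. complex_of_real ((norm (f t))\<^sup>2) \<partial>lebesgue)"
    using assms
    by (simp only: cinner_self[symmetric] cinner_abs_L2 complex_norm_square)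
  then show ?thesis by (simp only: integral_complex_of_real of_real_eq_iff)
qed

lemma nn_integral_norm_abs_L2:
  assumes "square_integrable f"
  shows "(\<integral>\<^sup>+t. ennreal ((norm (f t))\<^sup>2) \<partial>lebesgue) = ennreal ((norm (abs_L2 f))\<^sup>2)"
  unfolding norm_abs_L2[OF assms] using assms
  by (intro nn_integral_eq_integral) (auto simp: square_integrable_def)

text \<open>With \<open>g n = f (Suc n) - f n\<close>, the function \<open>\<Sum>n. 4 ^ n * (norm (g n))\<^sup>2\<close> has a finite
  integral, since the \<open>n\<close>-th term has integral at most \<open>(4/16) ^ n\<close>. At almost every point it is
  therefore finite, its terms are bounded, and \<open>norm (g n)\<close> is dominated by a multiple of
  \<open>(1/2) ^ n\<close>: the telescoping series converges.\<close>

lemma AE_convergent_of_fast_L2_Cauchy: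
  fixes f :: "nat \<Rightarrow> 'a::euclidean_space \<Rightarrow> complex"
  assumes f: "\<And>n. square_integrable (f n)"
    and fast: "\<And>n. (norm (abs_L2 (\<lambda>t. f (Suc n) t - f n t)))\<^sup>2 \<le> (1/16) ^ n"
  shows "AE t in lebesgue. convergent (\<lambda>n. f n t)"
proof -
  define g where "g n t = f (Suc n) t - f n t" for n t
  have g: "square_integrable (g n)" for n
    unfolding g_def by (intro square_integrable_diff f)
  have [measurable]: "g n \<in> borel_measurable lebesgue" for n
    using g by (simp add: square_integrable_def)
  have "(\<integral>\<^sup>+t. (\<Sum>n. ennreal (4 ^ n * (norm (g n t))\<^sup>2)) \<partial>lebesgue)
      = (\<Sum>n. \<integral>\<^sup>+t. ennreal (4 ^ n * (norm (g n t))\<^sup>2) \<partial>lebesgue)"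
    by (rule nn_integral_suminf) measurable
  also have "\<dots> = (\<Sum>n. ennreal (4 ^ n * (norm (abs_L2 (g n)))\<^sup>2))"
  proof (rule arg_cong[where f = suminf], rule ext)
    fix n
    show "(\<integral>\<^sup>+t. ennreal (4 ^ n * (norm (g n t))\<^sup>2) \<partial>lebesgue) = ennreal (4 ^ n * (norm (abs_L2 (g n)))\<^sup>2)"
      by (simp add: ennreal_mult nn_integral_cmult nn_integral_norm_abs_L2[OF g])
  qed
  also have "\<dots> \<le> (\<Sum>n. ennreal ((1/4) ^ n))"
  proof (intro suminf_le summableI ennreal_leI)
    fix n
    have "4 ^ n * (norm (abs_L2 (g n)))\<^sup>2 \<le> 4 ^ n * (1/16::real) ^ n"
      unfolding g_def by (intro mult_left_mono fast) auto
    also have "\<dots> = (1/4) ^ n"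
      by (simp flip: power_mult_distrib)
    finally show "4 ^ n * (norm (abs_L2 (g n)))\<^sup>2 \<le> (1/4) ^ n" .
  qed
  also have "\<dots> < \<infinity>"
    by (subst suminf_ennreal2) (auto intro!: summable_geometric)
  finally have "AE t in lebesgue. (\<Sum>n. ennreal (4 ^ n * (norm (g n t))\<^sup>2)) \<noteq> \<infinity>"
    by (intro nn_integral_PInf_AE) auto
  then show ?thesis
  proof eventually_elim
    fix t assume fin: "(\<Sum>n. ennreal (4 ^ n * (norm (g n t))\<^sup>2)) \<noteq> \<infinity>"
    have "summable (\<lambda>n. 4 ^ n * (norm (g n t))\<^sup>2)"
      using fin by (intro summable_suminf_not_top) auto
    then have "Bseq (\<lambda>n. 4 ^ n * (norm (g n t))\<^sup>2)"
      by (rule convergent_imp_Bseq[OF convergentI[OF summable_LIMSEQ_zero]])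
    then obtain C where C: "C > 0" "\<And>n. norm (4 ^ n * (norm (g n t))\<^sup>2) \<le> C"
      by (auto simp: Bseq_def)
    have bound: "norm (g n t) \<le> sqrt C * (1/2) ^ n" for n
    proof -
      have "(2 ^ n * norm (g n t))\<^sup>2 \<le> C"
        using C(2)[of n] by (simp add: power_mult_distrib power_mult[symmetric] mult.commute[of _ 2])
           (simp add: power_mult)
      then have "2 ^ n * norm (g n t) \<le> sqrt C"
        by (rule real_le_rsqrt)
      then show ?thesis by (simp add: field_simps power_divide)
    qed
    have "summable (\<lambda>n. g n t)"
      by (rule summable_comparison_test'[where g = "\<lambda>n. sqrt C * (1/2) ^ n" and N = 0])
         (auto intro!: summable_mult summable_geometric bound)
    then have "convergent (\<lambda>n. \<Sum>k<n. g k t)"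
      by (simp add: summable_iff_convergent)
    moreover have "(\<Sum>k<n. g k t) = f n t - f 0 t" for n
      unfolding g_def by (rule sum_lessThan_telescope)
    ultimately have "convergent (\<lambda>n. (f n t - f 0 t) + f 0 t)"
      by (intro convergent_add convergent_const) simp
    then show "convergent (\<lambda>n. f n t)" by simp
  qed
qed

text \<open>The pointwise limit of representatives is the limit in the norm as well, because Fatou's lemma
  passes the bound on \<open>norm (Y m - Y k)\<close> to the limit \<open>m \<longlonglongrightarrow> \<infinity>\<close>.\<close>

lemma L2_fast_Cauchy_convergent:
  fixes Y :: "nat \<Rightarrow> 'a::euclidean_space L2"
  assumes Y: "\<And>k m. k \<le> m \<Longrightarrow> norm (Y m - Y k) \<le> (1/4) ^ k"
  shows "convergent Y"
proof -
  define f where "f k = rep_L2 (Y k)" for k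
  have f: "square_integrable (f k)" and Yf: "Y k = abs_L2 (f k)" for k
    by (simp_all add: f_def square_integrable_rep abs_rep_L2)
  have [measurable]: "f k \<in> borel_measurable lebesgue" for k
    using f by (simp add: square_integrable_def)
  have d: "(norm (abs_L2 (\<lambda>t. f m t - f k t)))\<^sup>2 \<le> (1/16) ^ k" if "k \<le> m" for k m
  proof -
    have "(norm (Y m - Y k))\<^sup>2 \<le> ((1/4) ^ k)\<^sup>2"
      by (intro power_mono Y that) auto
    also have "\<dots> = (1/16) ^ k"
      by (simp add: power2_eq_square flip: power_mult_distrib)
    finally show ?thesis by (simp add: Yf abs_L2_diff f)
  qed
  have conv: "AE t in lebesgue. convergent (\<lambda>n. f n t)"
    by (rule AE_convergent_of_fast_L2_Cauchy[OF f d]) simp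
  define F where "F t = lim (\<lambda>n. f n t)" for t
  have [measurable]: "F \<in> borel_measurable lebesgue"
    unfolding F_def by (intro borel_measurable_lim_metric) measurable
  have Fk: "(\<integral>\<^sup>+t. ennreal ((norm (F t - f k t))\<^sup>2) \<partial>lebesgue) \<le> ennreal ((1/16) ^ k)" for k
  proof -
    have "(\<integral>\<^sup>+t. ennreal ((norm (F t - f k t))\<^sup>2) \<partial>lebesgue)
        = (\<integral>\<^sup>+t. liminf (\<lambda>m. ennreal ((norm (f m t - f k t))\<^sup>2)) \<partial>lebesgue)"
    proof (rule nn_integral_cong_AE, use conv in eventually_elim)
      fix t assume "convergent (\<lambda>n. f n t)"
      then have "(\<lambda>m. f m t) \<longlonglongrightarrow> F t"
        unfolding F_def by (simp add: convergent_LIMSEQ_iff)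
      then have "(\<lambda>m. ennreal ((norm (f m t - f k t))\<^sup>2)) \<longlonglongrightarrow> ennreal ((norm (F t - f k t))\<^sup>2)"
        by (intro tendsto_ennrealI tendsto_power tendsto_norm tendsto_diff tendsto_const)
      then show "ennreal ((norm (F t - f k t))\<^sup>2) = liminf (\<lambda>m. ennreal ((norm (f m t - f k t))\<^sup>2))"
        by (rule lim_imp_Liminf[OF sequentially_bot, symmetric])
    qed
    also have "\<dots> \<le> liminf (\<lambda>m. \<integral>\<^sup>+t. ennreal ((norm (f m t - f k t))\<^sup>2) \<partial>lebesgue)"
      by (rule nn_integral_liminf) measurable
    also have "\<dots> \<le> ennreal ((1/16) ^ k)"
    proof (rule Liminf_le)
      show "\<forall>\<^sub>F m in sequentially. (\<integral>\<^sup>+t. ennreal ((norm (f m t - f k t))\<^sup>2) \<partial>lebesgue) \<le> ennreal ((1/16) ^ k)"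
        using eventually_ge_at_top[of k]
      proof eventually_elim
        fix m assume "k \<le> m"
        show "(\<integral>\<^sup>+t. ennreal ((norm (f m t - f k t))\<^sup>2) \<partial>lebesgue) \<le> ennreal ((1/16) ^ k)"
          unfolding nn_integral_norm_abs_L2[OF square_integrable_diff[OF f f]]
          by (intro ennreal_leI d \<open>k \<le> m\<close>)
      qed
    qed simp
    finally show ?thesis .
  qed
  have sqd: "square_integrable (\<lambda>t. F t - f k t)" for k
  proof -
    have "integrable lebesgue (\<lambda>t. (norm (F t - f k t))\<^sup>2)"
    proof (rule integrableI_bounded)
      show "(\<integral>\<^sup>+t. ennreal (norm ((norm (F t - f k t))\<^sup>2)) \<partial>lebesgue) < \<infinity>"
        using le_less_trans[OF Fk[of k] ennreal_less_top] by simp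
    qed measurable
    then show ?thesis by (simp add: square_integrable_def)
  qed
  have sqF: "square_integrable F"
    using square_integrable_add[OF sqd[of 0] f[of 0]] by simp
  have le: "norm (Y k - abs_L2 F) \<le> (1/4) ^ k" for k
  proof -
    have "ennreal ((norm (abs_L2 F - Y k))\<^sup>2) \<le> ennreal ((1/16) ^ k)"
      using Fk[of k] unfolding nn_integral_norm_abs_L2[OF sqd] Yf abs_L2_diff[OF sqF f] .
    then have "(norm (abs_L2 F - Y k))\<^sup>2 \<le> (1/16) ^ k"
      by simp
    also have "\<dots> = ((1/4) ^ k)\<^sup>2"
      by (simp add: power2_eq_square flip: power_mult_distrib)
    finally have "norm (abs_L2 F - Y k) \<le> (1/4) ^ k"
      by (rule power2_le_imp_le) auto
    then show ?thesis by (simp add: norm_minus_commute)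
  qed
  have bnd: "(\<lambda>k. (1/4::real) ^ k) \<longlonglongrightarrow> 0"
    by (intro LIMSEQ_realpow_zero) auto
  have "(\<lambda>k. Y k - abs_L2 F) \<longlonglongrightarrow> 0"
    by (rule Lim_null_comparison[OF _ bnd]) (simp add: le)
  then show ?thesis
    by (intro convergentI[of _ "abs_L2 F"]) (rule LIM_zero_cancel)
qed

text \<open>Riesz--Fischer theorem: a Cauchy sequence converges as soon as a subsequence does, and a
  subsequence can be chosen to satisfy the geometric bound above.\<close>

instance L2 :: (euclidean_space) complete_space
proof
  fix X :: "nat \<Rightarrow> 'a L2"
  assume "Cauchy X"
  then have "\<exists>N. \<forall>m\<ge>N. \<forall>n\<ge>N. norm (X m - X n) < (1/4) ^ k" for k
    by (intro CauchyD) auto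
  then obtain N where N: "\<And>k m n. m \<ge> N k \<Longrightarrow> n \<ge> N k \<Longrightarrow> norm (X m - X n) < (1/4) ^ k"
    by metis
  define r where "r k = (\<Sum>j\<le>k. N j)" for k
  have r: "r m \<ge> N k" if "k \<le> m" for k m
    unfolding r_def using that by (intro member_le_sum) auto
  have "convergent (\<lambda>k. X (r k))"
    by (rule L2_fast_Cauchy_convergent) (meson N r le_refl less_imp_le)
  then obtain L where L: "(\<lambda>k. X (r k)) \<longlonglongrightarrow> L"
    by (auto simp: convergent_def)
  have "X \<longlonglongrightarrow> L"
  proof (rule LIMSEQ_I)
    fix e :: real assume e: "e > 0"
    have "\<forall>\<^sub>F k in sequentially. (1/4::real) ^ k < e/2"
      using e by (intro order_tendstoD(2)[OF LIMSEQ_realpow_zero]) auto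
    moreover have "\<forall>\<^sub>F k in sequentially. dist (X (r k)) L < e/2"
      using tendstoD[OF L, of "e/2"] e by simp
    ultimately have "\<forall>\<^sub>F k in sequentially. (1/4::real) ^ k < e/2 \<and> dist (X (r k)) L < e/2"
      by eventually_elim simp
    then obtain k where k: "(1/4::real) ^ k < e/2" "dist (X (r k)) L < e/2"
      by (auto simp: eventually_sequentially)
    have "norm (X n - L) < e" if "n \<ge> N k" for n
    proof -
      have "norm (X n - X (r k)) < e/2"
        using N[OF that r[OF order_refl]] k(1) by linarith
      moreover have "norm (X (r k) - L) < e/2"
        using k(2) by (simp add: dist_norm)
      ultimately show ?thesis
        using norm_triangle_ineq[of "X n - X (r k)" "X (r k) - L"] by simp
    qed
    then show "\<exists>no. \<forall>n\<ge>no. norm (X n - L) < e" by blast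
  qed
  then show "convergent X" by (rule convergentI)
qed

section \<open>Orthonormal expansions and the Riesz representation theorem\<close>

definition orthonormal :: "'a::euclidean_space L2 set \<Rightarrow> bool" where
  "orthonormal B \<longleftrightarrow> (\<forall>e\<in>B. \<forall>e'\<in>B. cinner e e' = (if e = e' then 1 else 0))"

lemma is_onb_iff: "is_onb B \<longleftrightarrow> orthonormal B \<and> (\<forall>\<psi>. (\<forall>e\<in>B. cinner \<psi> e = 0) \<longrightarrow> \<psi> = 0)"
  by (simp add: is_onb_def orthonormal_def)

lemma cinner_orthonormal_sum:
  assumes "orthonormal B" "finite F" "F \<subseteq> B" "e \<in> B"
  shows "cinner (\<Sum>e'\<in>F. scaleC (c e') e') e = (if e \<in> F then c e else 0)"
proof -
  have "cinner (\<Sum>e'\<in>F. scaleC (c e') e') e = (\<Sum>e'\<in>F. c e' * cinner e' e)"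
    by (simp add: cinner.sum_left cinner_scaleC_left)
  also have "\<dots> = (\<Sum>e'\<in>F. if e' = e then c e' else 0)"
    using assms by (intro sum.cong) (auto simp: orthonormal_def)
  finally show ?thesis using \<open>finite F\<close> by simp
qed

lemma norm_orthonormal_sum:
  assumes "orthonormal B" "finite F" "F \<subseteq> B"
  shows "(norm (\<Sum>e\<in>F. scaleC (c e) e))\<^sup>2 = (\<Sum>e\<in>F. (cmod (c e))\<^sup>2)"
proof -
  let ?p = "\<Sum>e\<in>F. scaleC (c e) e"
  have "complex_of_real ((norm ?p)\<^sup>2) = (\<Sum>e\<in>F. cnj (c e) * cinner ?p e)"
    by (simp only: cinner_self[symmetric] cinner.sum_right cinner_scaleC_right)
  also have "\<dots> = (\<Sum>e\<in>F. complex_of_real ((cmod (c e))\<^sup>2))"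
    using cinner_orthonormal_sum[OF assms] assms(3)
    by (intro sum.cong) (auto simp only: complex_norm_square mult.commute subset_eq if_True)
  finally show ?thesis by (simp only: of_real_sum[symmetric] of_real_eq_iff)
qed

lemma Bessel_inequality:
  assumes "orthonormal B" "finite F" "F \<subseteq> B"
  shows "(\<Sum>e\<in>F. (cmod (cinner \<psi> e))\<^sup>2) \<le> (norm \<psi>)\<^sup>2"
proof -
  let ?p = "\<Sum>e\<in>F. scaleC (cinner \<psi> e) e"
  have "cinner \<psi> ?p = of_real (\<Sum>e\<in>F. (cmod (cinner \<psi> e))\<^sup>2)"
    by (simp only: cinner.sum_right cinner_scaleC_right of_real_sum complex_norm_square mult.commute)
  then have "cinner \<psi> ?p = of_real ((norm ?p)\<^sup>2)"
    by (simp only: norm_orthonormal_sum[OF assms])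
  then have "(norm ?p)\<^sup>2 \<le> norm \<psi> * norm ?p"
    using cmod_cinner_le[of \<psi> ?p] by (simp add: norm_mult norm_power)
  then have "norm ?p \<le> norm \<psi>"
    by (cases "norm ?p = 0") (auto simp: power2_eq_square)
  then have "(norm ?p)\<^sup>2 \<le> (norm \<psi>)\<^sup>2"
    by (intro power_mono) auto
  then show ?thesis by (simp only: norm_orthonormal_sum[OF assms])
qed

lemma summable_on_norm_square_coefficients:
  assumes "orthonormal B"
  shows "(\<lambda>e. (cmod (cinner \<psi> e))\<^sup>2) summable_on B"
  using Bessel_inequality[OF assms]
  by (intro nonneg_bdd_above_summable_on) (auto simp: bdd_above_def)

text \<open>Finite partial sums form a Cauchy net: by Pythagoras, the distance of two nested ones is the
  square root of a difference of partial sums of \<open>(cmod (c e))\<^sup>2\<close>.\<close>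

lemma summable_on_orthonormal:
  assumes B: "orthonormal B" and c: "(\<lambda>e. (cmod (c e))\<^sup>2) summable_on B"
  shows "(\<lambda>e. scaleC (c e) e) summable_on B"
proof -
  let ?s = "\<lambda>F. \<Sum>e\<in>F. scaleC (c e) e" and ?n = "\<lambda>F. \<Sum>e\<in>F. (cmod (c e))\<^sup>2"
  obtain L where L: "(?n \<longlongrightarrow> L) (finite_subsets_at_top B)"
    using c unfolding has_sum_def summable_on_def by blast
  have "\<exists>P. eventually P (finite_subsets_at_top B) \<and>
              (\<forall>F F'. P F \<and> P F' \<longrightarrow> dist (?s F) (?s F') < d)" if d: "d > 0" for d
  proof -
    have "\<forall>\<^sub>F F in finite_subsets_at_top B. dist (?n F) L < d\<^sup>2 / 8"
      using d by (intro tendstoD[OF L]) auto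
    then have "\<exists>F0. finite F0 \<and> F0 \<subseteq> B \<and>
        (\<forall>F. finite F \<and> F0 \<subseteq> F \<and> F \<subseteq> B \<longrightarrow> dist (?n F) L < d\<^sup>2 / 8)"
      by (simp only: eventually_finite_subsets_at_top)
    then obtain F0 where F0: "finite F0" "F0 \<subseteq> B"
      and ball: "\<forall>F. finite F \<and> F0 \<subseteq> F \<and> F \<subseteq> B \<longrightarrow> dist (?n F) L < d\<^sup>2 / 8"
      by (elim exE conjE)
    have L8: "dist (?n F) L < d\<^sup>2 / 8" if "finite F" "F0 \<subseteq> F" "F \<subseteq> B" for F
      by (rule ball[rule_format]) (intro conjI that)
    have near: "dist (?s F) (?s F0) < d / 2" if F: "finite F" "F0 \<subseteq> F" "F \<subseteq> B" for F
    proof -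
      have "(norm (?s F - ?s F0))\<^sup>2 = ?n (F - F0)"
        using F by (subst sum_diff[symmetric]) (auto intro!: norm_orthonormal_sum[OF B])
      also have "\<dots> = ?n F - ?n F0"
        using F by (simp add: sum_diff)
      also have "\<dots> < (d / 2)\<^sup>2"
        using L8[OF F] L8[OF F0(1) order_refl F0(2)] zero_less_power[OF d, of 2]
        unfolding dist_real_def power_divide abs_less_iff by simp
      finally have "norm (?s F - ?s F0) < d / 2"
        by (rule power2_less_imp_less) (use d in simp)
      then show ?thesis
        by (simp only: dist_norm)
    qed
    have "eventually (\<lambda>F. finite F \<and> F0 \<subseteq> F \<and> F \<subseteq> B) (finite_subsets_at_top B)"
      using F0(1,2) unfolding eventually_finite_subsets_at_top by blast
    moreover have "dist (?s F) (?s F') < d"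
      if "finite F \<and> F0 \<subseteq> F \<and> F \<subseteq> B" "finite F' \<and> F0 \<subseteq> F' \<and> F' \<subseteq> B" for F F'
      using near[of F] near[of F'] that dist_triangle_half_l[of "?s F" "?s F0" d "?s F'"] by blast
    ultimately show ?thesis
      by (intro exI[of _ "\<lambda>F. finite F \<and> F0 \<subseteq> F \<and> F \<subseteq> B"] conjI allI impI) auto
  qed
  then have "cauchy_filter (filtermap ?s (finite_subsets_at_top B))"
    by (simp add: cauchy_filter_metric_filtermap)
  then have "convergent_filter (filtermap ?s (finite_subsets_at_top B))"
    by (rule cauchy_filter_convergent)
  then show ?thesis
    by (auto simp: convergent_filter_iff summable_on_def has_sum_def filterlim_def)
qed

lemma cinner_has_sum_orthonormal:
  assumes B: "orthonormal B" and v: "((\<lambda>e. scaleC (c e) e) has_sum v) B" and e: "e \<in> B"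
  shows "cinner v e = c e"
proof -
  have "((\<lambda>e'. cinner (scaleC (c e') e') e) has_sum cinner v e) B"
    by (rule has_sum_bounded_linear[OF cinner.bounded_linear_left v])
  moreover have "((\<lambda>e'. cinner (scaleC (c e') e') e) has_sum c e) B"
    by (rule has_sum_finite_neutralI[of "{e}"])
       (use B e in \<open>auto simp: cinner_scaleC_left orthonormal_def\<close>)
  ultimately show ?thesis by (rule has_sum_unique)
qed

text \<open>The series converges by Bessel's inequality and completeness, and the difference between
  \<open>\<psi>\<close> and its sum is orthogonal to every basis vector.\<close>

lemma onb_expansion:
  assumes "is_onb B"
  shows "((\<lambda>e. scaleC (cinner \<psi> e) e) has_sum \<psi>) B"
proof -
  have B: "orthonormal B" using assms by (simp add: is_onb_iff)
  obtain v where v: "((\<lambda>e. scaleC (cinner \<psi> e) e) has_sum v) B"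
    using summable_on_orthonormal[OF B summable_on_norm_square_coefficients[OF B]]
    by (auto simp: summable_on_def)
  have "\<forall>e\<in>B. cinner (\<psi> - v) e = 0"
    using cinner_has_sum_orthonormal[OF B v] by (simp add: cinner.diff_left)
  then have "\<psi> - v = 0" using assms unfolding is_onb_iff by blast
  with v show ?thesis by simp
qed

lemma Parseval:
  assumes "is_onb B"
  shows "((\<lambda>e. cinner \<psi> e * cinner e \<xi>) has_sum cinner \<psi> \<xi>) B"
  using has_sum_bounded_linear[OF cinner.bounded_linear_left[of \<xi>] onb_expansion[OF assms, of \<psi>]]
  by (simp add: cinner_scaleC_left)

text \<open>An orthonormal set that is maximal for inclusion (Zorn's lemma) is total, since a nonzero vector
  orthogonal to it could be normalised and added.\<close>

theorem is_onb_onb: "is_onb (onb :: 'a::euclidean_space L2 set)"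
proof -
  have "\<exists>M\<in>Collect orthonormal. \<forall>X\<in>Collect orthonormal. M \<subseteq> X \<longrightarrow> X = (M :: 'a L2 set)"
  proof (rule subset_Zorn')
    fix C :: "'a L2 set set"
    assume C: "subset.chain (Collect orthonormal) C"
    have "cinner e e' = (if e = e' then 1 else 0)" if "X \<in> C" "Y \<in> C" "e \<in> X" "e' \<in> Y" for X Y e e'
    proof -
      have "X \<subseteq> Y \<or> Y \<subseteq> X" "orthonormal X" "orthonormal Y"
        using C that(1,2) by (auto simp: subset_chain_def)
      with that(3,4) show ?thesis
        unfolding orthonormal_def by blast
    qed
    then show "\<Union>C \<in> Collect orthonormal"
      by (auto simp: orthonormal_def)
  qed
  then obtain M :: "'a L2 set" where M: "orthonormal M" "\<And>X. orthonormal X \<Longrightarrow> M \<subseteq> X \<Longrightarrow> X = M"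
    by auto
  have "\<psi> = 0" if perp: "\<forall>e\<in>M. cinner \<psi> e = 0" for \<psi>
  proof (rule ccontr)
    assume "\<psi> \<noteq> 0"
    define u where "u = scaleC (of_real (inverse (norm \<psi>))) \<psi>"
    have uu: "cinner u u = 1"
      using \<open>\<psi> \<noteq> 0\<close> unfolding cinner_self u_def norm_scaleC by (simp add: norm_inverse)
    have ue: "cinner u e = 0" if "e \<in> M" for e
      using perp that by (simp add: u_def cinner_scaleC_left)
    then have eu: "cinner e u = 0" if "e \<in> M" for e
      using that by (subst cinner_commute) simp
    have "orthonormal (insert u M)"
      unfolding orthonormal_def
    proof (intro ballI)
      fix e e' assume "e \<in> insert u M" "e' \<in> insert u M"
      then show "cinner e e' = (if e = e' then 1 else 0)"
        using M(1) uu ue eu unfolding orthonormal_def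
        by (metis insert_iff)
    qed
    from M(2)[OF this] have "u \<in> M" by auto
    with ue uu show False by force
  qed
  then have "is_onb M" using M(1) by (simp add: is_onb_iff)
  then show ?thesis unfolding onb_def by (rule someI)
qed

text \<open>The representing vector has to be \<open>\<Sum>e\<in>onb. scaleC (cnj (l e)) e\<close>. The series converges because
  \<open>l\<close> maps the partial sum \<open>v\<close> over a finite set to \<open>(norm v)\<^sup>2\<close>, whence \<open>norm v\<close> is at most the bound
  of \<open>l\<close>.\<close>

lemma Riesz_representation:
  fixes l :: "'a::euclidean_space L2 \<Rightarrow> complex"
  assumes l: "bounded_linear l" and hom: "\<And>c x. l (scaleC c x) = c * l x"
  shows "\<exists>v. \<forall>x. l x = cinner x v"
proof -
  interpret l: bounded_linear l by fact
  let ?B = "onb :: 'a L2 set"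
  have B: "orthonormal ?B" using is_onb_onb[where 'a = 'a] by (simp add: is_onb_iff)
  obtain K where K: "K \<ge> 0" "\<And>x. cmod (l x) \<le> norm x * K"
    using l.nonneg_bounded by auto
  have "(\<lambda>e. (cmod (cnj (l e)))\<^sup>2) summable_on ?B"
  proof (rule nonneg_bdd_above_summable_on)
    show "bdd_above (sum (\<lambda>e. (cmod (cnj (l e)))\<^sup>2) ` {F. F \<subseteq> ?B \<and> finite F})"
    proof (rule bdd_aboveI2, safe)
      fix F :: "'a L2 set" assume F: "F \<subseteq> ?B" "finite F"
      let ?v = "\<Sum>e\<in>F. scaleC (cnj (l e)) e" and ?N = "\<Sum>e\<in>F. (cmod (cnj (l e)))\<^sup>2"
      have v: "(norm ?v)\<^sup>2 = ?N"
        by (rule norm_orthonormal_sum[OF B F(2,1)])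
      have "l ?v = of_real ?N"
        by (simp only: l.sum hom of_real_sum complex_norm_square complex_cnj_cnj)
      then have "cmod (l ?v) = ?N"
        by (simp only: norm_of_real) (simp add: sum_nonneg)
      then have "(norm ?v)\<^sup>2 \<le> norm ?v * K"
        using K(2)[of ?v] v by linarith
      then have "norm ?v \<le> K"
        using K(1) by (cases "norm ?v = 0") (auto simp: power2_eq_square)
      then have "(norm ?v)\<^sup>2 \<le> K\<^sup>2"
        by (intro power_mono) auto
      with v show "?N \<le> K\<^sup>2" by simp
    qed
  qed simp
  then obtain v where v: "((\<lambda>e. scaleC (cnj (l e)) e) has_sum v) ?B"
    using summable_on_orthonormal[OF B, of "\<lambda>e. cnj (l e)"] unfolding summable_on_def by blast
  have ve: "cinner e v = l e" if "e \<in> ?B" for e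
    by (subst cinner_commute) (simp add: cinner_has_sum_orthonormal[OF B v that])
  have "l x = cinner x v" for x
  proof -
    have "((\<lambda>e. cinner x e * l e) has_sum l x) ?B"
      using has_sum_bounded_linear[OF l onb_expansion[OF is_onb_onb, of x]] by (simp add: hom)
    moreover have "((\<lambda>e. cinner x e * l e) has_sum cinner x v) ?B"
      using Parseval[OF is_onb_onb, of x v] ve by (simp cong: has_sum_cong)
    ultimately show ?thesis by (rule has_sum_unique)
  qed
  then show ?thesis by blast
qed

text \<open>This turns the weak definition of an operator by its matrix coefficients into an operator.\<close>

lemma bounded_op_of_sesquilinear:
  fixes b :: "'a::euclidean_space L2 \<Rightarrow> 'a L2 \<Rightarrow> complex"
  assumes add_left: "\<And>x y z. b (x + y) z = b x z + b y z"
    and add_right: "\<And>x y z. b x (y + z) = b x y + b x z"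
    and hom_left: "\<And>c x y. b (scaleC c x) y = c * b x y"
    and hom_right: "\<And>c x y. b x (scaleC c y) = cnj c * b x y"
    and bound: "\<And>x y. cmod (b x y) \<le> K * norm x * norm y"
  shows "\<exists>T. bounded_op T \<and> (\<forall>x y. cinner (T x) y = b x y)"
proof -
  have "\<exists>v. \<forall>y. cnj (b x y) = cinner y v" for x
  proof (rule Riesz_representation)
    show "bounded_linear (\<lambda>y. cnj (b x y))"
    proof
      show "\<exists>K. \<forall>y. cmod (cnj (b x y)) \<le> norm y * K"
        using bound[of x] by (intro exI[of _ "K * norm x"]) (simp add: mult.commute)
    qed (simp_all add: add_right hom_right scaleR_L2_def scaleR_conv_of_real)
  qed (simp add: hom_right)
  then obtain T where "\<And>x y. cnj (b x y) = cinner y (T x)"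
    by metis
  then have T: "cinner (T x) y = b x y" for x y
    by (metis cinner_commute complex_cnj_cnj)
  have hom: "T (scaleC c x) = scaleC c (T x)" for c x
    by (rule cinner_left_ext) (simp add: T hom_left cinner_scaleC_left)
  have "bounded_linear T"
  proof
    show "T (x + y) = T x + T y" for x y
      by (rule cinner_left_ext) (simp add: T add_left cinner_add_left)
    show "T (r *\<^sub>R x) = r *\<^sub>R T x" for r x
      by (simp add: scaleR_L2_def hom)
    have "norm (T x) \<le> norm x * K" for x
    proof -
      have "(norm (T x))\<^sup>2 \<le> K * norm x * norm (T x)"
        using bound[of x "T x"] by (simp add: T[symmetric] cinner_self norm_power)
      moreover have "0 \<le> norm x * K"
        using order_trans[OF norm_ge_zero bound[of x x]]
        by (cases "x = 0") (auto simp: zero_le_mult_iff)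
      ultimately show ?thesis
        by (cases "norm (T x) = 0") (auto simp: power2_eq_square mult.commute)
    qed
    then show "\<exists>K. \<forall>x. norm (T x) \<le> norm x * K" by blast
  qed
  then show ?thesis using hom T by (auto simp: bounded_op_def)
qed

section \<open>Positive operators and their square roots\<close>

lemma Re_cinner_le: "Re (cinner x y) \<le> norm x * norm y"
  by (rule order_trans[OF complex_Re_le_cmod cmod_cinner_le])

text \<open>Polarisation: \<open>Im (cinner (A z) z) = 0\<close> at \<open>z = x + y\<close> and \<open>z = x + \<i> y\<close> gives the imaginary and
  the real part of the identity.\<close>

lemma positive_op_selfadjoint:
  assumes "positive_op A"
  shows "cinner (A x) y = cinner x (A y)"
proof -
  interpret A: bounded_linear A using assms by (simp add: positive_op_def bounded_op_def)
  have hom: "A (scaleC c x) = scaleC c (A x)" for c x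
    using assms by (simp add: positive_op_def bounded_op_def)
  have "Im (cinner (A x) x) = 0" for x
    using assms by (auto simp: positive_op_def complex_nonneg_Reals_iff)
  from this[of "x + y"] this[of "x + scaleC \<i> y"] this[of x] this[of y]
  have "cinner (A x) y = cnj (cinner (A y) x)"
    by (simp add: A.add hom cinner_add_left cinner_add_right cinner_scaleC_left
        cinner_scaleC_right complex_eq_iff)
  then show ?thesis by (metis cinner_commute)
qed

lemma adj_eqI:
  assumes "bounded_op B" "\<And>\<psi> \<xi>. cinner (A \<psi>) \<xi> = cinner \<psi> (B \<xi>)"
  shows "adj A = B"
  unfolding adj_def
proof (rule the_equality)
  fix B' assume B': "bounded_op B' \<and> (\<forall>\<psi> \<xi>. cinner (A \<psi>) \<xi> = cinner \<psi> (B' \<xi>))"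
  show "B' = B"
    by (rule ext, rule cinner_right_ext) (use assms(2) B' in metis)
qed (use assms in simp)

lemma adj_positive_op: "positive_op A \<Longrightarrow> adj A = A"
  by (intro adj_eqI positive_op_selfadjoint) (auto simp: positive_op_def)

text \<open>The form \<open>cinner (A x) y\<close> is positive semidefinite, so the real quadratic
  \<open>t \<mapsto> cinner (A z) z\<close> at \<open>z = x + t b y\<close>, where \<open>b = cinner (A x) y\<close>, is nonnegative.\<close>

lemma positive_op_Cauchy_Schwarz:
  assumes A: "positive_op A"
  shows "(cmod (cinner (A x) y))\<^sup>2 \<le> Re (cinner (A x) x) * Re (cinner (A y) y)"
proof -
  interpret A: bounded_linear A using A by (simp add: positive_op_def bounded_op_def)
  have hom: "A (scaleC c x) = scaleC c (A x)" for c x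
    using A by (simp add: positive_op_def bounded_op_def)
  define a b c where "a = Re (cinner (A x) x)" and "b = cinner (A x) y" and "c = Re (cinner (A y) y)"
  have xx: "cinner (A x) x = of_real a" and yy: "cinner (A y) y = of_real c"
    using A by (auto simp: positive_op_def complex_nonneg_Reals_iff complex_eq_iff a_def c_def)
  have yx: "cinner (A y) x = cnj b"
    unfolding b_def by (metis cinner_commute positive_op_selfadjoint[OF A])
  have quad: "0 \<le> a + 2 * t * (cmod b)\<^sup>2 + t\<^sup>2 * (cmod b)\<^sup>2 * c" for t :: real
  proof -
    let ?z = "x + scaleC (of_real t * b) y"
    have "cinner (A ?z) ?z = of_real a + 2 * of_real t * (b * cnj b) + (of_real t)\<^sup>2 * (b * cnj b) * of_real c"
      by (simp add: A.add hom cinner_add_left cinner_add_right cinner_scaleC_left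
          cinner_scaleC_right xx yy yx b_def[symmetric] power2_eq_square algebra_simps)
    also have "\<dots> = of_real (a + 2 * t * (cmod b)\<^sup>2 + t\<^sup>2 * (cmod b)\<^sup>2 * c)"
      by (simp add: complex_norm_square[symmetric])
    finally show ?thesis
      using A by (metis positive_op_def complex_nonneg_Reals_iff Re_complex_of_real)
  qed
  have a: "0 \<le> a" and c: "0 \<le> c"
    using A by (auto simp: positive_op_def complex_nonneg_Reals_iff a_def c_def)
  have "(cmod b)\<^sup>2 \<le> a * c"
  proof (cases "c = 0")
    case True
    have "cmod b = 0"
    proof (rule ccontr)
      assume "cmod b \<noteq> 0"
      then have "0 \<le> a + 2 * (- (a + 1) / (cmod b)\<^sup>2) * (cmod b)\<^sup>2"
        using quad[of "- (a + 1) / (cmod b)\<^sup>2"] True by simp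
      moreover have "2 * (- (a + 1) / (cmod b)\<^sup>2) * (cmod b)\<^sup>2 = - 2 * (a + 1)"
        using \<open>cmod b \<noteq> 0\<close> by simp
      ultimately have "0 \<le> a - 2 * (a + 1)"
        by linarith
      with a show False by simp
    qed
    with True show ?thesis by simp
  next
    case False
    with c have "c > 0" by simp
    then have "0 \<le> a - (cmod b)\<^sup>2 / c"
      using quad[of "- 1 / c"] by (simp add: power2_eq_square field_simps)
    then show ?thesis using \<open>c > 0\<close> by (simp add: field_simps)
  qed
  then show ?thesis by (simp add: a_def b_def c_def)
qed

text \<open>Small \<open>cinner (A x) x\<close> forces small \<open>A x\<close>: apply the previous inequality to \<open>y = A x\<close>.\<close>

lemma positive_op_norm_square_le:
  assumes A: "positive_op A" and K: "\<And>x. norm (A x) \<le> norm x * K"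
  shows "(norm (A x))\<^sup>2 \<le> K * Re (cinner (A x) x)"
proof (cases "A x = 0")
  case True
  then show ?thesis by (simp add: cinner.zero_left)
next
  case False
  let ?n = "(norm (A x))\<^sup>2" and ?q = "Re (cinner (A x) x)"
  have q: "?q \<ge> 0" using A by (auto simp: positive_op_def complex_nonneg_Reals_iff)
  have "?n\<^sup>2 \<le> ?q * Re (cinner (A (A x)) (A x))"
    using positive_op_Cauchy_Schwarz[OF A, of x "A x"] by (simp add: cinner_self norm_power)
  also have "\<dots> \<le> ?q * (K * ?n)"
  proof (rule mult_left_mono[OF _ q])
    have "Re (cinner (A (A x)) (A x)) \<le> norm (A (A x)) * norm (A x)"
      by (rule Re_cinner_le)
    also have "\<dots> \<le> (norm (A x) * K) * norm (A x)"
      by (intro mult_right_mono K) auto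
    finally show "Re (cinner (A (A x)) (A x)) \<le> K * ?n"
      by (simp add: power2_eq_square mult_ac)
  qed
  finally have "?n * ?n \<le> ?n * (K * ?q)"
    by (simp add: power2_eq_square mult_ac)
  moreover have "?n > 0" using False by simp
  ultimately show ?thesis by (simp only: mult_le_cancel_left_pos)
qed

text \<open>Let \<open>D = P - T\<close> and \<open>A = P + T\<close>. From \<open>P\<^sup>2 = T\<^sup>2\<close> it follows that \<open>D A = - A D\<close>, although \<open>P\<close> and
  \<open>T\<close> are not known to commute. Let \<open>M\<close> be the operator norm of \<open>D\<close> and suppose \<open>M > 0\<close>. If a unit
  vector \<open>x\<close> almost attains the norm of \<open>D\<close>, then \<open>D\<^sup>2 x\<close> is almost \<open>M\<^sup>2 x\<close>, so
  \<open>0 \<le> \<langle>A D x, D x\<rangle> = - \<langle>A x, D\<^sup>2 x\<rangle>\<close> is almost \<open>- M\<^sup>2 \<langle>A x, x\<rangle> \<le> 0\<close>. Hence \<open>\<langle>P x, x\<rangle>\<close> and \<open>\<langle>T x, x\<rangle>\<close> are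
  almost \<open>0\<close>, and so are \<open>P x\<close>, \<open>T x\<close> and \<open>D x\<close>, which contradicts the choice of \<open>x\<close>. In the
  proof this is made quantitative, as a bound of \<open>norm (D x)\<close> by \<open>sqrt q * M * norm x\<close> with
  \<open>q < 1\<close>.\<close>

lemma positive_op_sqrt_unique:
  assumes P: "positive_op P" and T: "positive_op T" and eq: "P \<circ> P = T \<circ> T"
  shows "P = T"
proof -
  interpret P: bounded_linear P using P by (simp add: positive_op_def bounded_op_def)
  interpret T: bounded_linear T using T by (simp add: positive_op_def bounded_op_def)
  define D where "D x = P x - T x" for x
  define A where "A x = P x + T x" for x
  have "bounded_linear D" "bounded_linear A"
    unfolding D_def[abs_def] A_def[abs_def]
    by (intro bounded_linear_sub bounded_linear_add P.bounded_linear_axioms T.bounded_linear_axioms)+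
  then interpret D: bounded_linear D + A: bounded_linear A .
  have sq: "P (P x) = T (T x)" for x
    using eq by (metis comp_apply)
  have anti: "D (A x) = - A (D x)" for x
    by (simp add: D_def A_def P.add P.diff T.add T.diff sq)
  have Dsa: "cinner (D x) y = cinner x (D y)" for x y
    by (simp add: D_def cinner.diff_left cinner.diff_right positive_op_selfadjoint[OF P]
        positive_op_selfadjoint[OF T])
  have pos: "0 \<le> Re (cinner (P x) x)" "0 \<le> Re (cinner (T x) x)" for x
    using P T by (auto simp: positive_op_def complex_nonneg_Reals_iff)
  obtain KP where KP: "KP > 0" "\<And>x. norm (P x) \<le> norm x * KP" using P.pos_bounded by blast
  obtain KT where KT: "KT > 0" "\<And>x. norm (T x) \<le> norm x * KT" using T.pos_bounded by blast
  define M where "M = onorm D"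
  have DM: "norm (D x) \<le> M * norm x" for x
    unfolding M_def by (rule onorm[OF D.bounded_linear_axioms])
  have M0: "M \<ge> 0" unfolding M_def by (rule onorm_pos_le[OF D.bounded_linear_axioms])
  \<comment> \<open>\<open>\<langle>A x, D\<^sup>2 x\<rangle> \<le> 0\<close>, so replacing \<open>D\<^sup>2 x\<close> by \<open>M\<^sup>2 x\<close> costs only the defect \<open>D\<^sup>2 x - M\<^sup>2 x\<close>\<close>
  have key: "M\<^sup>2 * Re (cinner (A x) x) \<le> norm (A x) * norm (D (D x) - M\<^sup>2 *\<^sub>R x)" for x
  proof -
    have "cinner (A (D x)) (D x) = - cinner (A x) (D (D x))"
      using Dsa[of "A x" "D x"] by (simp add: anti cinner.minus_left)
         (metis add.inverse_inverse)
    moreover have "0 \<le> Re (cinner (A (D x)) (D x))"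
      using pos[of "D x"] by (simp add: A_def cinner_add_left)
    ultimately have "Re (cinner (A x) (D (D x))) \<le> 0" by simp
    moreover have "Re (cinner (A x) (M\<^sup>2 *\<^sub>R x - D (D x))) \<le> norm (A x) * norm (D (D x) - M\<^sup>2 *\<^sub>R x)"
      using Re_cinner_le[of "A x" "M\<^sup>2 *\<^sub>R x - D (D x)"] by (simp only: norm_minus_commute)
    ultimately show ?thesis
      by (simp add: cinner.diff_right cinner.scaleR_right)
  qed
  have defect: "(norm (D (D x) - M\<^sup>2 *\<^sub>R x))\<^sup>2 \<le> M\<^sup>2 * (M\<^sup>2 * (norm x)\<^sup>2 - (norm (D x))\<^sup>2)" for x
  proof -
    have yx: "inner (D (D x)) x = (norm (D x))\<^sup>2"
      using Dsa[of "D x" x] by (simp add: inner_L2_def cinner_self)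
    then have xy: "inner x (D (D x)) = (norm (D x))\<^sup>2"
      by (simp only: inner_commute)
    have "(norm (D (D x) - M\<^sup>2 *\<^sub>R x))\<^sup>2
        = (norm (D (D x)))\<^sup>2 - 2 * M\<^sup>2 * (norm (D x))\<^sup>2 + M\<^sup>2 * (M\<^sup>2 * (norm x)\<^sup>2)"
      by (simp add: power2_norm_eq_inner[of "D (D x) - M\<^sup>2 *\<^sub>R x"] inner_diff_left inner_diff_right
          yx xy power2_norm_eq_inner[of x, symmetric] power2_norm_eq_inner[of "D (D x)", symmetric])
         (simp add: algebra_simps power4_eq_xxxx power2_eq_square[of M])
    moreover have "(norm (D (D x)))\<^sup>2 \<le> M\<^sup>2 * (norm (D x))\<^sup>2"
      using power_mono[OF DM[of "D x"], of 2] by (simp add: power_mult_distrib)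
    ultimately show ?thesis by (simp add: algebra_simps)
  qed
  have "M = 0"
  proof (rule ccontr)
    assume "M \<noteq> 0"
    with M0 have Mpos: "M > 0" by simp
    define K where "K = 2 * (KP + KT)"
    have K: "K > 0" using KP KT by (simp add: K_def)
    have Dq: "(norm (D x))\<^sup>2 \<le> K * Re (cinner (A x) x)" for x
    proof -
      have "(norm (D x))\<^sup>2 \<le> (norm (P x) + norm (T x))\<^sup>2"
        unfolding D_def by (intro power_mono norm_triangle_ineq4) auto
      also have "\<dots> \<le> 2 * (norm (P x))\<^sup>2 + 2 * (norm (T x))\<^sup>2"
        using sum_squares_bound[of "norm (P x)" "norm (T x)"] by (simp add: power2_sum)
      also have "\<dots> \<le> 2 * (KP * Re (cinner (P x) x)) + 2 * (KT * Re (cinner (T x) x))"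
        using positive_op_norm_square_le[OF P KP(2), of x]
          positive_op_norm_square_le[OF T KT(2), of x] by linarith
      also have "\<dots> \<le> K * Re (cinner (P x) x) + K * Re (cinner (T x) x)"
        using mult_right_mono[OF _ pos(1), of "2 * KP" K x]
          mult_right_mono[OF _ pos(2), of "2 * KT" K x] KP(1) KT(1)
        by (simp add: K_def)
      finally show ?thesis by (simp add: A_def cinner_add_left algebra_simps)
    qed
    obtain KA where KA: "KA > 0" "\<And>x. norm (A x) \<le> norm x * KA" using A.pos_bounded by blast
    have lower: "M\<^sup>2 * (norm (D x))\<^sup>2 \<le> K * KA * norm x * norm (D (D x) - M\<^sup>2 *\<^sub>R x)" for x
    proof -
      have "M\<^sup>2 * (norm (D x))\<^sup>2 \<le> M\<^sup>2 * (K * Re (cinner (A x) x))"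
        by (intro mult_left_mono Dq) auto
      also have "\<dots> = K * (M\<^sup>2 * Re (cinner (A x) x))" by simp
      also have "\<dots> \<le> K * (norm (A x) * norm (D (D x) - M\<^sup>2 *\<^sub>R x))"
        using K by (intro mult_left_mono key) auto
      also have "\<dots> \<le> K * ((norm x * KA) * norm (D (D x) - M\<^sup>2 *\<^sub>R x))"
        using K by (intro mult_left_mono mult_right_mono KA(2)) auto
      finally show ?thesis by (simp add: mult_ac)
    qed
    define k where "k = K * KA"
    have k: "k > 0" using K KA by (simp add: k_def)
    define v where "v = k\<^sup>2 / M\<^sup>2"
    have v: "v > 0" using k Mpos by (simp add: v_def)
    \<comment> \<open>Young's inequality with this weight \<open>v\<close> absorbs the defect into \<open>(norm (D x))\<^sup>2\<close>\<close>
    have gap: "(2 * M\<^sup>2 + v) * (norm (D x))\<^sup>2 \<le> (M\<^sup>2 + v) * (M\<^sup>2 * (norm x)\<^sup>2)" for x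
    proof -
      let ?\<delta> = "norm (D (D x) - M\<^sup>2 *\<^sub>R x)"
      have "2 * (M\<^sup>2 * (norm (D x))\<^sup>2) \<le> 2 * (M\<^sup>2 * norm x) * (k / M\<^sup>2 * ?\<delta>)"
        using lower[of x] Mpos by (simp add: k_def mult_ac)
      also have "\<dots> \<le> (M\<^sup>2 * norm x)\<^sup>2 + (k / M\<^sup>2 * ?\<delta>)\<^sup>2"
        by (rule sum_squares_bound)
      also have "(k / M\<^sup>2 * ?\<delta>)\<^sup>2 = v / M\<^sup>2 * ?\<delta>\<^sup>2"
        by (simp add: v_def power_mult_distrib power_divide power2_eq_square)
      also have "(M\<^sup>2 * norm x)\<^sup>2 + v / M\<^sup>2 * ?\<delta>\<^sup>2
          \<le> (M\<^sup>2 * norm x)\<^sup>2 + v / M\<^sup>2 * (M\<^sup>2 * (M\<^sup>2 * (norm x)\<^sup>2 - (norm (D x))\<^sup>2))"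
        using v Mpos by (intro add_left_mono mult_left_mono defect) auto
      also have "\<dots> = (M\<^sup>2 * norm x)\<^sup>2 + v * (M\<^sup>2 * (norm x)\<^sup>2 - (norm (D x))\<^sup>2)"
        using Mpos by simp
      finally show ?thesis
        by (simp add: algebra_simps power_mult_distrib power2_eq_square[of "M\<^sup>2"])
    qed
    define q where "q = (M\<^sup>2 + v) / (2 * M\<^sup>2 + v)"
    have q: "0 < q" "q < 1"
      using v Mpos by (simp_all add: q_def add_pos_pos)
    have "norm (D x) \<le> sqrt q * M * norm x" for x
    proof -
      have "(norm (D x))\<^sup>2 \<le> q * (M\<^sup>2 * (norm x)\<^sup>2)"
        using gap[of x] v Mpos by (simp add: q_def pos_le_divide_eq add_pos_pos mult.commute)
      also have "\<dots> = (sqrt q * M * norm x)\<^sup>2"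
        using q by (simp add: power_mult_distrib)
      finally show ?thesis
        by (rule power2_le_imp_le) (use q Mpos in simp)
    qed
    then have "M \<le> sqrt q * M"
      unfolding M_def using q M0 by (intro onorm_bound) (simp_all add: M_def)
    moreover have "sqrt q < 1" using q by simp
    ultimately show False using Mpos by simp
  qed
  then have "D x = 0" for x using DM[of x] by simp
  then show ?thesis by (auto simp: D_def)
qed

lemma abs_op_positive_op: "positive_op A \<Longrightarrow> abs_op A = A"
  unfolding abs_op_def
  by (rule the_equality) (auto simp: adj_positive_op intro: positive_op_sqrt_unique)

section \<open>Countability of orthonormal sets\<close>

lemma ex_borel_representative:
  fixes f :: "'a::euclidean_space \<Rightarrow> complex"
  assumes f: "f \<in> borel_measurable lebesgue"
  obtains g where "g \<in> borel_measurable borel" "AE t in lebesgue. f t = g t"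
proof -
  have "(\<lambda>t. Re (f t)) \<in> borel_measurable lebesgue" "(\<lambda>t. Im (f t)) \<in> borel_measurable lebesgue"
    using f by (auto simp: borel_measurable_complex_iff)
  from this[THEN completion_ex_borel_measurable_real]
  obtain u w where uw: "u \<in> borel_measurable lborel" "w \<in> borel_measurable lborel"
    and ae: "AE t in lborel. Re (f t) = u t" "AE t in lborel. Im (f t) = w t"
    by auto
  show ?thesis
  proof
    show "(\<lambda>t. Complex (u t) (w t)) \<in> borel_measurable borel"
      using uw by (simp add: borel_measurable_complex_iff)
    show "AE t in lebesgue. f t = Complex (u t) (w t)"
      using ae[THEN AE_completion] by eventually_elim (simp add: complex_eq_iff)
  qed
qed

text \<open>The sets over which \<open>v\<close> integrates to zero form a Dynkin system, so \<open>v\<close> integrates to zero over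
  every Borel set. A Borel representative of \<open>v\<close> moves the argument from the completed measure to
  \<open>lborel\<close>.\<close>

lemma AE_eq_0_if_integrals_over_generator_eq_0:
  fixes v :: "'a::euclidean_space \<Rightarrow> complex"
  assumes v: "integrable lebesgue v"
    and E: "Int_stable E" "UNIV \<in> E" "sets borel = sigma_sets UNIV E"
    and zero: "\<And>X. X \<in> E \<Longrightarrow> (LINT t:X|lebesgue. v t) = 0"
  shows "AE t in lebesgue. v t = 0"
proof -
  obtain g where g [measurable]: "g \<in> borel_measurable borel" and vg: "AE t in lebesgue. v t = g t"
    using ex_borel_representative[OF borel_measurable_integrable[OF v]] by blast
  have gl [measurable]: "g \<in> borel_measurable lebesgue"
    by (rule measurable_completion) simp
  have "integrable lebesgue g"
    using v vg by (subst integrable_cong_AE[where g = v]) (auto elim: eventually_mono)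
  then have gi: "integrable lborel g"
    by (simp add: integrable_completion)
  have base: "(LINT t:X|lborel. g t) = 0" if "X \<in> E" for X
  proof -
    have X: "X \<in> sets borel" using that E(3) by (auto intro: sigma_sets.Basic)
    then have Xl: "X \<in> sets lebesgue" by simp
    have "(LINT t:X|lborel. g t) = (LINT t:X|lebesgue. g t)"
      unfolding set_lebesgue_integral_def using X by (intro integral_completion[symmetric]) simp
    also have "\<dots> = (LINT t:X|lebesgue. v t)"
      unfolding set_lebesgue_integral_def
    proof (rule integral_cong_AE)
      show "AE t in lebesgue. indicat_real X t *\<^sub>R g t = indicat_real X t *\<^sub>R v t"
        using vg by eventually_elim simp
      show "(\<lambda>t. indicat_real X t *\<^sub>R g t) \<in> borel_measurable lebesgue"
        using gl Xl by simp
      show "(\<lambda>t. indicat_real X t *\<^sub>R v t) \<in> borel_measurable lebesgue"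
        using borel_measurable_integrable[OF v] Xl by simp
    qed
    finally show ?thesis using zero[OF that] by simp
  qed
  have "(LINT t:X|lborel. g t) = 0" if "X \<in> sets borel" for X
  proof -
    have "E \<subseteq> Pow UNIV" by simp
    from E(1) this that[unfolded E(3)] show ?thesis
    proof (induction rule: sigma_sets_induct_disjoint)
      case (basic A)
      then show ?case by (rule base)
    next
      case empty
      show ?case by (simp add: set_lebesgue_integral_def)
    next
      case (compl A)
      then have A: "A \<in> sets lborel" using E(3) by simp
      have "(LINT t:UNIV - A|lborel. g t)
          = (\<integral>t. indicat_real UNIV t *\<^sub>R g t - indicat_real A t *\<^sub>R g t \<partial>lborel)"
        unfolding set_lebesgue_integral_def
        by (intro Bochner_Integration.integral_cong) (auto simp: indicator_def)
      also have "\<dots> = (LINT t:UNIV|lborel. g t) - (LINT t:A|lborel. g t)"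
        unfolding set_lebesgue_integral_def
        by (intro Bochner_Integration.integral_diff integrable_mult_indicator A gi) simp
      finally show ?case using compl.IH base[OF E(2)] by simp
    next
      case (union A)
      then have A: "A i \<in> sets lborel" for i
        using E(3) by (simp add: image_subset_iff)
      have "(LINT t:(\<Union>i. A i)|lborel. g t) = (\<Sum>i. LINT t:A i|lborel. g t)"
      proof (rule lebesgue_integral_countable_add[OF A])
        show "A i \<inter> A j = {}" if "i \<noteq> j" for i j
          using union.hyps(1) that by (auto simp: disjoint_family_on_def)
        show "set_integrable lborel (\<Union>i. A i) g"
          unfolding set_integrable_def using A by (intro integrable_mult_indicator gi) auto
      qed
      then show ?case using union.IH by simp
    qed
  qed
  then have "AE t in lborel. g t = 0"
    by (intro sigma_finite_measure.density_zero[OF sigma_finite_lborel gi]) simp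
  then have "AE t in lebesgue. g t = 0"
    by (rule AE_completion)
  with vg show ?thesis by eventually_elim simp
qed

lemma square_integrable_indicator:
  assumes "X \<in> sets lebesgue" "bounded (X :: 'a::euclidean_space set)"
  shows "square_integrable (\<lambda>t. indicator X t)"
proof -
  have "integrable lebesgue (indicator X :: 'a \<Rightarrow> real)"
    using assms lmeasurable_iff_integrable bounded_set_imp_lmeasurable by blast
  moreover have "(\<lambda>t. (cmod (indicator X t))\<^sup>2) = indicator X"
    by (auto simp: indicator_def)
  ultimately show ?thesis
    using assms(1) by (simp add: square_integrable_def borel_measurable_indicator)
qed

text \<open>The indicators of \<open>cball 0 n \<inter> X\<close> separate, where \<open>X\<close> runs through the finite intersections of a
  countable basis of the topology. Intersections make the family of all \<open>X\<close> stable and put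
  \<open>UNIV\<close> into it, as the empty intersection; the balls make the indicators square integrable.\<close>

lemma countable_separating_L2:
  "\<exists>G :: 'a::euclidean_space L2 set. countable G \<and> (\<forall>\<psi>. (\<forall>g\<in>G. cinner \<psi> g = 0) \<longrightarrow> \<psi> = 0)"
proof -
  obtain \<B> :: "'a set set" where \<B>: "countable \<B>" "topological_basis \<B>"
    using ex_countable_basis by auto
  define E where "E = Inter ` {F. finite F \<and> F \<subseteq> \<B>}"
  have "countable E"
    unfolding E_def using \<B>(1) by (intro countable_image countable_Collect_finite_subset)
  have "Int_stable E"
    unfolding E_def Int_stable_def
  proof safe
    fix F F' assume "F \<subseteq> \<B>" "finite F" "F' \<subseteq> \<B>" "finite F'"
    then show "\<Inter>F \<inter> \<Inter>F' \<in> Inter ` {F. finite F \<and> F \<subseteq> \<B>}"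
      by (intro image_eqI[of _ _ "F \<union> F'"]) auto
  qed
  have "UNIV \<in> E"
    unfolding E_def by (intro image_eqI[of _ _ "{}"]) auto
  have open_E: "open X" if "X \<in> E" for X
    using that topological_basis_open[OF \<B>(2)] unfolding E_def by (auto intro!: open_Inter)
  have "\<B> \<subseteq> E"
  proof
    fix X assume "X \<in> \<B>"
    then show "X \<in> E" unfolding E_def by (intro image_eqI[of _ _ "{X}"]) auto
  qed
  have sig: "sets borel = sigma_sets UNIV E"
  proof
    show "sets borel \<subseteq> sigma_sets UNIV E"
      using \<open>\<B> \<subseteq> E\<close> by (simp add: borel_eq_countable_basis[OF \<B>] sigma_sets_mono')
    show "sigma_sets UNIV E \<subseteq> sets borel"
      using open_E sets.sigma_sets_subset[of E borel] by (metis borel_open space_borel subsetI)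
  qed
  define c where "c n X = abs_L2 (\<lambda>t. indicator (cball 0 (real n) \<inter> X) t)" for n and X :: "'a set"
  have "\<psi> = 0" if perp: "\<And>n X. X \<in> E \<Longrightarrow> cinner \<psi> (c n X) = 0" for \<psi>
  proof -
    define f where "f = rep_L2 \<psi>"
    have f: "square_integrable f" and \<psi>: "\<psi> = abs_L2 f"
      by (simp_all add: f_def square_integrable_rep abs_rep_L2)
    have "AE t in lebesgue. f t * indicator (cball 0 (real n)) t = 0" for n
    proof (rule AE_eq_0_if_integrals_over_generator_eq_0[OF _ \<open>Int_stable E\<close> \<open>UNIV \<in> E\<close> sig])
      have "square_integrable (\<lambda>t::'a. indicator (cball 0 (real n)) t)"
        by (rule square_integrable_indicator) auto
      from integrable_mult_cnj[OF f this]
      show "integrable lebesgue (\<lambda>t. f t * indicator (cball 0 (real n)) t)"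
        by (rule back_subst[where P = "integrable lebesgue"]) (auto simp: indicator_def)
      fix X assume X: "X \<in> E"
      have "square_integrable (\<lambda>t::'a. indicator (cball 0 (real n) \<inter> X) t)"
        using open_E[OF X] by (intro square_integrable_indicator) (auto intro: bounded_Int)
      from cinner_abs_L2[OF f this]
      have "(\<integral>t. f t * cnj (indicator (cball 0 (real n) \<inter> X) t) \<partial>lebesgue) = 0"
        using perp[OF X, of n] by (simp add: \<psi> c_def)
      also have "(\<integral>t. f t * cnj (indicator (cball 0 (real n) \<inter> X) t) \<partial>lebesgue)
          = (LINT t:X|lebesgue. f t * indicator (cball 0 (real n)) t)"
        unfolding set_lebesgue_integral_def
        by (intro Bochner_Integration.integral_cong) (auto simp: indicator_def)
      finally show "(LINT t:X|lebesgue. f t * indicator (cball 0 (real n)) t) = 0" .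
    qed
    then have "AE t in lebesgue. \<forall>n. f t * indicator (cball 0 (real n)) t = 0"
      unfolding AE_all_countable by blast
    then have "AE t in lebesgue. f t = 0"
    proof eventually_elim
      fix t assume *: "\<forall>n. f t * indicator (cball 0 (real n)) t = 0"
      obtain n where "norm t \<le> real n" using real_arch_simple by blast
      with *[rule_format, of n] show "f t = 0" by (simp add: indicator_def)
    qed
    then show ?thesis
      unfolding \<psi> zero_L2_def by (intro abs_L2_eqI f square_integrable_zero)
  qed
  moreover have "countable ((\<lambda>(n, X). c n X) ` (UNIV \<times> E))"
    using \<open>countable E\<close> by auto
  ultimately show ?thesis
    by (intro exI[of _ "(\<lambda>(n, X). c n X) ` (UNIV \<times> E)"]) auto
qed

text \<open>By Bessel's inequality, each vector of a countable separating set meets only countably many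
  elements of \<open>B\<close> with nonzero inner product, and every element of \<open>B\<close> is met by one of them.\<close>

lemma countable_orthonormal:
  assumes B: "orthonormal (B :: 'a::euclidean_space L2 set)"
  shows "countable B"
proof -
  obtain G :: "'a L2 set" where G: "countable G" "\<And>\<psi>. (\<forall>g\<in>G. cinner \<psi> g = 0) \<Longrightarrow> \<psi> = 0"
    using countable_separating_L2 by blast
  have "countable (\<Union>g\<in>G. {e\<in>B. (cmod (cinner g e))\<^sup>2 \<noteq> 0})"
    using G(1) by (intro countable_UN summable_countable_real
        summable_on_norm_square_coefficients[OF B])
  moreover have "B \<subseteq> (\<Union>g\<in>G. {e\<in>B. (cmod (cinner g e))\<^sup>2 \<noteq> 0})"
  proof
    fix e assume "e \<in> B"
    then have "cinner e e = 1" using B by (simp add: orthonormal_def)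
    then have "e \<noteq> 0" by (auto simp: cinner.zero_left)
    then obtain g where "g \<in> G" "cinner e g \<noteq> 0" using G(2)[of e] by blast
    then have "cinner g e \<noteq> 0" by (subst cinner_commute) simp
    with \<open>g \<in> G\<close> \<open>e \<in> B\<close> show "e \<in> (\<Union>g\<in>G. {e\<in>B. (cmod (cinner g e))\<^sup>2 \<noteq> 0})" by auto
  qed
  ultimately show ?thesis by (rule countable_subset[rotated])
qed

lemma countable_onb: "countable (onb :: 'a::euclidean_space L2 set)"
  using is_onb_onb[where 'a = 'a] unfolding is_onb_iff by (blast intro: countable_orthonormal)

section \<open>Basis independence of the trace\<close>

lemma has_sum_finite_sum:
  fixes f :: "'i \<Rightarrow> 'b \<Rightarrow> 'c::topological_comm_monoid_add"
  assumes "finite I" "\<And>i. i \<in> I \<Longrightarrow> (f i has_sum s i) A"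
  shows "((\<lambda>x. \<Sum>i\<in>I. f i x) has_sum (\<Sum>i\<in>I. s i)) A"
  using assms by (induction I rule: finite_induct) (auto intro!: has_sum_add)

text \<open>Let \<open>Q E f\<close> be the projection of \<open>f\<close> to the span of a finite \<open>E \<subseteq> B\<close>. For fixed \<open>E\<close>, Parseval's
  identity for \<open>C\<close> shows that the sum of \<open>\<langle>S (Q E f), Q E f\<rangle>\<close> over \<open>f \<in> C\<close> is the partial trace
  \<open>\<Sum>e\<in>E. \<langle>S e, e\<rangle>\<close>; only finite sums over \<open>E\<close> are exchanged with the sum over \<open>C\<close>. For finite
  \<open>F \<subseteq> C\<close>, let \<open>E\<close> grow to \<open>B\<close>.\<close>

lemma trace_partial_sum_le:
  fixes S :: "'a::euclidean_space L2 \<Rightarrow> 'a L2"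
  assumes S: "positive_op S" and B: "is_onb B" and C: "is_onb C"
    and t: "((\<lambda>e. Re (cinner (S e) e)) has_sum t) B" and F: "finite F" "F \<subseteq> C"
  shows "(\<Sum>f\<in>F. Re (cinner (S f) f)) \<le> t"
proof -
  interpret S: bounded_linear S using S by (simp add: positive_op_def bounded_op_def)
  have hom: "S (scaleC c x) = scaleC c (S x)" for c x
    using S by (simp add: positive_op_def bounded_op_def)
  have pos: "0 \<le> Re (cinner (S x) x)" for x
    using S by (auto simp: positive_op_def complex_nonneg_Reals_iff)
  define Q where "Q E f = (\<Sum>e\<in>E. scaleC (cinner f e) e)" for E and f :: "'a L2"
  have Q: "((\<lambda>E. Q E f) \<longlongrightarrow> f) (finite_subsets_at_top B)" for f
    using onb_expansion[OF B, of f] unfolding has_sum_def Q_def .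
  have lim: "((\<lambda>E. \<Sum>f\<in>F. Re (cinner (S (Q E f)) (Q E f))) \<longlongrightarrow> (\<Sum>f\<in>F. Re (cinner (S f) f)))
      (finite_subsets_at_top B)"
    by (intro tendsto_sum tendsto_Re cinner.tendsto S.tendsto Q)
  have "(\<Sum>f\<in>F. Re (cinner (S (Q E f)) (Q E f))) \<le> t" if E: "finite E" "E \<subseteq> B" for E
  proof -
    have "((\<lambda>f. cinner (S (Q E f)) (Q E f)) has_sum (\<Sum>e\<in>E. \<Sum>e'\<in>E. cinner (S e) e' * cinner e' e)) C"
    proof -
      have "((\<lambda>f. \<Sum>e\<in>E. \<Sum>e'\<in>E. cinner (S e) e' * (cinner e' f * cinner f e))
          has_sum (\<Sum>e\<in>E. \<Sum>e'\<in>E. cinner (S e) e' * cinner e' e)) C"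
        by (intro has_sum_finite_sum E(1) has_sum_cmult_right Parseval[OF C])
      moreover have "cinner (S (Q E f)) (Q E f)
          = (\<Sum>e\<in>E. \<Sum>e'\<in>E. cinner (S e) e' * (cinner e' f * cinner f e))" for f
        by (subst sum.swap) (simp add: Q_def S.sum hom cinner.sum_left cinner.sum_right cinner_scaleC_left
            cinner_scaleC_right cinner_commute[of _ f, symmetric] sum_distrib_left mult_ac)
      ultimately show ?thesis by simp
    qed
    moreover have "(\<Sum>e\<in>E. \<Sum>e'\<in>E. cinner (S e) e' * cinner e' e) = (\<Sum>e\<in>E. cinner (S e) e)"
    proof (rule sum.cong[OF refl])
      fix e assume e: "e \<in> E"
      have "(\<Sum>e'\<in>E. cinner (S e) e' * cinner e' e) = (\<Sum>e'\<in>E. if e' = e then cinner (S e) e' else 0)"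
        using B E(2) e by (intro sum.cong) (auto simp: is_onb_def subset_eq)
      also have "\<dots> = cinner (S e) e" using E(1) e by simp
      finally show "(\<Sum>e'\<in>E. cinner (S e) e' * cinner e' e) = cinner (S e) e" .
    qed
    ultimately have "((\<lambda>f. Re (cinner (S (Q E f)) (Q E f))) has_sum (\<Sum>e\<in>E. Re (cinner (S e) e))) C"
      using has_sum_Re by fastforce
    then have "(\<Sum>f\<in>F. Re (cinner (S (Q E f)) (Q E f))) \<le> (\<Sum>e\<in>E. Re (cinner (S e) e))"
      using F by (intro finite_sum_le_has_sum pos)
    also have "\<dots> \<le> t"
      using E by (intro finite_sum_le_has_sum[OF t] pos)
    finally show ?thesis .
  qed
  then have "\<forall>\<^sub>F E in finite_subsets_at_top B. (\<Sum>f\<in>F. Re (cinner (S (Q E f)) (Q E f))) \<le> t"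
    by (intro eventually_finite_subsets_at_top_weakI)
  then show ?thesis
    by (intro tendsto_upperbound[OF lim]) auto
qed

lemma trace_basis_independent:
  assumes S: "positive_op S" and B: "is_onb B" and C: "is_onb C"
    and t: "((\<lambda>e. Re (cinner (S e) e)) has_sum t) B"
  shows "((\<lambda>e. Re (cinner (S e) e)) has_sum t) C"
proof -
  have pos: "0 \<le> Re (cinner (S x) x)" for x
    using S by (auto simp: positive_op_def complex_nonneg_Reals_iff)
  have "(\<lambda>e. Re (cinner (S e) e)) summable_on C"
    using trace_partial_sum_le[OF S B C t] pos
    by (intro nonneg_bdd_above_summable_on) (auto simp: bdd_above_def)
  then obtain t' where t': "((\<lambda>e. Re (cinner (S e) e)) has_sum t') C"
    by (auto simp: summable_on_def)
  have "t' \<le> t"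
    by (rule has_sum_le_finite_sums[OF t' trace_partial_sum_le[OF S B C t]])
  moreover have "t \<le> t'"
    by (rule has_sum_le_finite_sums[OF t trace_partial_sum_le[OF S C B t']])
  ultimately show ?thesis using t' by simp
qed

section \<open>Time-frequency shifts are unitary\<close>

lemma tf_shift_abs_L2:
  assumes "square_integrable f"
  shows "tf_shift (x, \<omega>) (abs_L2 f) = abs_L2 (\<lambda>t. cis (2 * pi * (\<omega> \<bullet> t)) * f (t - x))"
  using tf_shift.abs_eq[OF L2_rel_refl[OF assms], of "(x, \<omega>)"] by simp

lemma tf_shift_add: "tf_shift z (\<psi> + \<xi>) = tf_shift z \<psi> + tf_shift z \<xi>"
proof (cases z)
  case (Pair x \<omega>)
  obtain f g where [simp]: "\<psi> = abs_L2 f" "\<xi> = abs_L2 g" "square_integrable f" "square_integrable g"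
    by (metis abs_rep_L2 square_integrable_rep)
  show ?thesis
    by (simp add: Pair plus_L2.abs_eq L2_rel_refl tf_shift_abs_L2 square_integrable_add
        square_integrable_shift distrib_left)
qed

lemma tf_shift_scaleC: "tf_shift z (scaleC c \<psi>) = scaleC c (tf_shift z \<psi>)"
proof (cases z)
  case (Pair x \<omega>)
  obtain f where [simp]: "\<psi> = abs_L2 f" "square_integrable f"
    by (metis abs_rep_L2 square_integrable_rep)
  show ?thesis
    by (simp add: Pair scaleC.abs_eq L2_rel_refl tf_shift_abs_L2 square_integrable_mult
        square_integrable_shift mult.left_commute)
qed

lemma tf_shift_zero: "tf_shift (0, 0) \<psi> = \<psi>"
  by (metis (no_types, lifting) tf_shift_abs_L2[of _ 0 0, simplified] abs_rep_L2 square_integrable_rep)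

lemma tf_shift_tf_shift:
  "tf_shift (x, \<omega>) (tf_shift (x', \<omega>') \<psi>) = scaleC (cis (- 2 * pi * (\<omega>' \<bullet> x))) (tf_shift (x + x', \<omega> + \<omega>') \<psi>)"
proof -
  obtain f where [simp]: "\<psi> = abs_L2 f" "square_integrable f"
    by (metis abs_rep_L2 square_integrable_rep)
  have "cis (2 * pi * (\<omega> \<bullet> t)) * (cis (2 * pi * (\<omega>' \<bullet> (t - x))) * f (t - x - x'))
      = cis (- 2 * pi * (\<omega>' \<bullet> x)) * (cis (2 * pi * ((\<omega> + \<omega>') \<bullet> t)) * f (t - (x + x')))" for t
  proof -
    have "2 * pi * (\<omega> \<bullet> t) + 2 * pi * (\<omega>' \<bullet> (t - x))
        = - 2 * pi * (\<omega>' \<bullet> x) + 2 * pi * ((\<omega> + \<omega>') \<bullet> t)"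
      by (simp add: inner_diff_right inner_add_left distrib_left right_diff_distrib)
    then show ?thesis
      by (simp only: mult.assoc[symmetric] cis_mult diff_diff_eq)
  qed
  then show ?thesis
    by (simp add: scaleC.abs_eq L2_rel_refl tf_shift_abs_L2 square_integrable_shift)
qed

lemma cinner_tf_shift:
  "cinner (tf_shift (x, \<omega>) \<psi>) \<xi>
    = cinner \<psi> (scaleC (cis (- 2 * pi * (\<omega> \<bullet> x))) (tf_shift (- x, - \<omega>) \<xi>))"
proof -
  obtain f g where [simp]: "\<psi> = abs_L2 f" "\<xi> = abs_L2 g" "square_integrable f" "square_integrable g"
    by (metis abs_rep_L2 square_integrable_rep)
  have sq: "square_integrable (\<lambda>t. cis (2 * pi * (- \<omega> \<bullet> t)) * g (t - - x))"
    by (rule square_integrable_shift) simp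
  define h where "h t = f t * cnj (cis (- 2 * pi * (\<omega> \<bullet> x)) * (cis (2 * pi * (- \<omega> \<bullet> t)) * g (t - - x)))" for t
  have "h \<in> borel_measurable lebesgue"
    unfolding h_def
    by (intro borel_measurable_integrable integrable_mult_cnj square_integrable_mult sq) simp
  have shift: "h (t - x) = cis (2 * pi * (\<omega> \<bullet> t)) * f (t - x) * cnj (g t)" for t
  proof -
    have "cnj (cis (- 2 * pi * (\<omega> \<bullet> x)) * cis (2 * pi * (- \<omega> \<bullet> (t - x)))) = cis (2 * pi * (\<omega> \<bullet> t))"
      by (simp add: cis_mult cis_cnj inner_diff_right algebra_simps)
    then show ?thesis
      by (simp add: h_def mult_ac)
  qed
  have "cinner (tf_shift (x, \<omega>) \<psi>) \<xi> = (\<integral>t. h (t - x) \<partial>lebesgue)"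
    by (simp add: shift tf_shift_abs_L2 cinner_abs_L2 square_integrable_shift)
  also have "\<dots> = (\<integral>t. h t \<partial>distr lebesgue lebesgue (\<lambda>t. t - x))"
    by (rule integral_distr[symmetric]) (fact measurable_lebesgue_translation \<open>h \<in> _\<close>)+
  also have "\<dots> = (\<integral>t. h t \<partial>lebesgue)"
    by (simp only: distr_lebesgue_translation)
  also have "\<dots> = cinner \<psi> (scaleC (cis (- 2 * pi * (\<omega> \<bullet> x))) (tf_shift (- x, - \<omega>) \<xi>))"
    using sq unfolding h_def
    by (simp add: tf_shift_abs_L2 scaleC.abs_eq L2_rel_refl cinner_abs_L2 square_integrable_mult
        del: complex_cnj_mult)
  finally show ?thesis .
qed

text \<open>The inverse of \<open>tf_shift z\<close>, which is a shift by \<open>- z\<close> up to a phase.\<close>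

definition tf_unshift :: "'a \<times> 'a \<Rightarrow> 'a::euclidean_space L2 \<Rightarrow> 'a L2" where
  "tf_unshift z \<psi> = scaleC (cis (- 2 * pi * (snd z \<bullet> fst z))) (tf_shift (- fst z, - snd z) \<psi>)"

lemma cinner_tf_shift_left: "cinner (tf_shift z \<psi>) \<xi> = cinner \<psi> (tf_unshift z \<xi>)"
  by (cases z) (simp add: tf_unshift_def cinner_tf_shift)

lemma tf_unshift_tf_shift: "tf_unshift z (tf_shift z \<psi>) = \<psi>"
  by (cases z) (simp add: tf_unshift_def tf_shift_tf_shift scaleC_scaleC cis_mult tf_shift_zero scaleC_one)

lemma tf_shift_tf_unshift: "tf_shift z (tf_unshift z \<psi>) = \<psi>"
  by (cases z) (simp add: tf_unshift_def tf_shift_scaleC tf_shift_tf_shift scaleC_scaleC cis_mult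
      tf_shift_zero scaleC_one)

lemma cinner_tf_unshift: "cinner (tf_unshift z \<psi>) (tf_unshift z \<xi>) = cinner \<psi> \<xi>"
  by (metis cinner_tf_shift_left tf_shift_tf_unshift)

lemma norm_tf_unshift: "norm (tf_unshift z \<psi>) = norm \<psi>"
  by (simp add: norm_eq_sqrt_inner inner_L2_def cinner_tf_unshift)

lemma tf_unshift_add: "tf_unshift z (\<psi> + \<xi>) = tf_unshift z \<psi> + tf_unshift z \<xi>"
  by (simp add: tf_unshift_def tf_shift_add scaleC_add_right)

lemma tf_unshift_scaleC: "tf_unshift z (scaleC c \<psi>) = scaleC c (tf_unshift z \<psi>)"
  by (simp add: tf_unshift_def tf_shift_scaleC scaleC_scaleC mult.commute)

lemma adj_tf_shift: "adj (tf_shift z) = tf_unshift z"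
proof (rule adj_eqI)
  have "bounded_linear (tf_unshift z)"
  proof
    show "\<exists>K. \<forall>x. norm (tf_unshift z x) \<le> norm x * K"
      by (rule exI[of _ 1]) (simp add: norm_tf_unshift)
  qed (simp_all add: tf_unshift_add scaleR_L2_def tf_unshift_scaleC)
  then show "bounded_op (tf_unshift z)"
    by (simp add: bounded_op_def tf_unshift_scaleC)
qed (rule cinner_tf_shift_left)

lemma cinner_op_translate:
  "cinner (op_translate z S \<psi>) \<xi> = cinner (S (tf_unshift z \<psi>)) (tf_unshift z \<xi>)"
  by (simp add: op_translate_def adj_tf_shift cinner_tf_shift_left)

lemma is_onb_tf_unshift:
  assumes B: "is_onb B"
  shows "is_onb (tf_unshift z ` B)"
  unfolding is_onb_def
proof (intro conjI ballI allI impI)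
  fix e e' assume "e \<in> tf_unshift z ` B" "e' \<in> tf_unshift z ` B"
  then show "cinner e e' = (if e = e' then 1 else 0)"
    using B by (auto simp: cinner_tf_unshift is_onb_def)
next
  fix \<psi> assume "\<forall>e\<in>tf_unshift z ` B. cinner \<psi> e = 0"
  then have "\<forall>e\<in>B. cinner (tf_shift z \<psi>) e = 0"
    by (simp add: cinner_tf_shift_left)
  then have "tf_shift z \<psi> = 0"
    using B by (simp add: is_onb_def)
  then have "cinner \<psi> \<psi> = 0"
    by (metis cinner.zero_left cinner_tf_shift_left tf_unshift_tf_shift)
  then show "\<psi> = 0" by (simp add: cinner_self)
qed

lemma inj_tf_unshift: "inj (tf_unshift z)"
  by (metis injI tf_shift_tf_unshift)

section \<open>Countable sums of functions\<close>

lemma ex_exhausting_finite_subsets: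
  assumes "countable A"
  obtains F :: "nat \<Rightarrow> 'a set"
  where "\<And>n. finite (F n)" "\<And>n. F n \<subseteq> A" "filterlim F (finite_subsets_at_top A) sequentially"
proof
  let ?F = "\<lambda>n. {x \<in> A. to_nat_on A x \<le> n}"
  show "?F n \<subseteq> A" for n by auto
  have inj: "inj_on (to_nat_on A) A" using assms by (rule inj_on_to_nat_on)
  show fin: "finite (?F n)" for n
  proof (rule finite_imageD)
    show "finite (to_nat_on A ` ?F n)"
      by (rule finite_subset[of _ "{..n}"]) auto
    show "inj_on (to_nat_on A) (?F n)"
      using inj by (rule inj_on_subset) auto
  qed
  show "filterlim ?F (finite_subsets_at_top A) sequentially"
    unfolding filterlim_iff eventually_finite_subsets_at_top
  proof (intro allI impI, elim exE conjE)
    fix P X assume X: "finite X" "X \<subseteq> A" and P: "\<forall>Y. finite Y \<and> X \<subseteq> Y \<and> Y \<subseteq> A \<longrightarrow> P Y"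
    obtain N where "\<forall>k \<in> to_nat_on A ` X. k \<le> N"
      using X(1) finite_nat_set_iff_bounded_le by blast
    then have sub: "X \<subseteq> ?F n" if "n \<ge> N" for n
      using X(2) that by fastforce
    then show "\<forall>\<^sub>F n in sequentially. P (?F n)"
      unfolding eventually_sequentially
    proof (intro exI allI impI)
      fix n assume "N \<le> n"
      show "P (?F n)"
        by (rule P[rule_format]) (use sub[OF \<open>N \<le> n\<close>] fin in auto)
    qed
  qed
qed

lemma borel_measurable_has_sum:
  fixes f :: "'i \<Rightarrow> 'b \<Rightarrow> complex"
  assumes A: "countable A" and f: "\<And>i. i \<in> A \<Longrightarrow> f i \<in> borel_measurable M"
    and g: "\<And>z. ((\<lambda>i. f i z) has_sum g z) A"
  shows "g \<in> borel_measurable M"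
proof -
  obtain F :: "nat \<Rightarrow> 'i set" where F: "\<And>n. F n \<subseteq> A" "filterlim F (finite_subsets_at_top A) sequentially"
    using ex_exhausting_finite_subsets[OF A] by metis
  show ?thesis
  proof (rule borel_measurable_LIMSEQ_metric)
    show "(\<lambda>z. \<Sum>i\<in>F n. f i z) \<in> borel_measurable M" for n
      using F(1) f by (intro borel_measurable_sum) blast
    show "(\<lambda>n. \<Sum>i\<in>F n. f i z) \<longlonglongrightarrow> g z" for z
      using filterlim_compose[OF g[unfolded has_sum_def] F(2)] .
  qed
qed

text \<open>Countability lets one exhaust \<open>A\<close> by a sequence of finite sets, along which dominated
  convergence applies; the partial sums of nonnegative terms are dominated by \<open>h\<close>.\<close>

lemma has_sum_integral_nonneg:
  fixes f :: "'i \<Rightarrow> 'b \<Rightarrow> real"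
  assumes A: "countable A" and f: "\<And>i. i \<in> A \<Longrightarrow> integrable M (f i)"
    and nonneg: "\<And>i. i \<in> A \<Longrightarrow> AE z in M. 0 \<le> f i z"
    and h: "integrable M h" and sum: "AE z in M. ((\<lambda>i. f i z) has_sum h z) A"
  shows "((\<lambda>i. \<integral>z. f i z \<partial>M) has_sum (\<integral>z. h z \<partial>M)) A"
proof -
  have nonneg': "AE z in M. \<forall>i\<in>A. 0 \<le> f i z"
    using nonneg by (simp add: AE_ball_countable[OF A])
  have part: "AE z in M. (\<Sum>i\<in>E. f i z) \<le> h z" if "finite E" "E \<subseteq> A" for E
    using nonneg' sum
  proof eventually_elim
    case (elim z)
    then show ?case using that by (intro finite_sum_le_has_sum[OF elim(2)]) auto
  qed
  have int: "(\<Sum>i\<in>E. \<integral>z. f i z \<partial>M) = (\<integral>z. (\<Sum>i\<in>E. f i z) \<partial>M)" "integrable M (\<lambda>z. \<Sum>i\<in>E. f i z)"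
    if "E \<subseteq> A" for E
    using that f by (auto intro!: Bochner_Integration.integral_sum[symmetric] Bochner_Integration.integrable_sum)
  have "(\<Sum>i\<in>E. \<integral>z. f i z \<partial>M) \<le> (\<integral>z. h z \<partial>M)" if "finite E" "E \<subseteq> A" for E
    unfolding int(1)[OF that(2)] by (intro integral_mono_AE int h part that)
  then have "(\<lambda>i. \<integral>z. f i z \<partial>M) summable_on A"
    using nonneg by (intro nonneg_bdd_above_summable_on integral_nonneg_AE) (auto simp: bdd_above_def)
  then obtain s where s: "((\<lambda>i. \<integral>z. f i z \<partial>M) has_sum s) A"
    by (auto simp: summable_on_def)
  obtain F :: "nat \<Rightarrow> 'i set" where F: "\<And>n. finite (F n)" "\<And>n. F n \<subseteq> A"
      "filterlim F (finite_subsets_at_top A) sequentially"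
    using ex_exhausting_finite_subsets[OF A] by metis
  have "(\<lambda>n. \<Sum>i\<in>F n. \<integral>z. f i z \<partial>M) \<longlonglongrightarrow> s"
    using filterlim_compose[OF s[unfolded has_sum_def] F(3)] .
  moreover have "(\<lambda>n. \<integral>z. (\<Sum>i\<in>F n. f i z) \<partial>M) \<longlonglongrightarrow> (\<integral>z. h z \<partial>M)"
  proof (rule integral_dominated_convergence)
    show "h \<in> borel_measurable M" using h by (rule borel_measurable_integrable)
    show "(\<lambda>z. \<Sum>i\<in>F n. f i z) \<in> borel_measurable M" for n
      using int(2)[OF F(2)] by (rule borel_measurable_integrable)
    show "AE z in M. (\<lambda>n. \<Sum>i\<in>F n. f i z) \<longlonglongrightarrow> h z"
      using sum
    proof eventually_elim
      case (elim z)
      show ?case using filterlim_compose[OF elim[unfolded has_sum_def] F(3)] .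
    qed
    show "AE z in M. norm (\<Sum>i\<in>F n. f i z) \<le> h z" for n
      using nonneg' part[OF F(1,2)[of n]]
    proof eventually_elim
      case (elim z)
      have "0 \<le> (\<Sum>i\<in>F n. f i z)" using elim(1) F(2)[of n] by (intro sum_nonneg) auto
      with elim(2) show ?case by simp
    qed
  qed (fact h)
  ultimately have "s = (\<integral>z. h z \<partial>M)"
    using int(1)[OF F(2)] by (simp add: LIMSEQ_unique)
  with s show ?thesis by simp
qed

section \<open>Measurability of translated matrix coefficients\<close>

lemma ex_borel_L2:
  obtains p where "p \<in> borel_measurable borel" "square_integrable p" "\<psi> = abs_L2 p"
proof -
  let ?f = "rep_L2 \<psi>"
  have f: "square_integrable ?f" by (rule square_integrable_rep)
  then have fm: "?f \<in> borel_measurable lebesgue" by (simp add: square_integrable_def)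
  then obtain p where p: "p \<in> borel_measurable borel" "AE t in lebesgue. ?f t = p t"
    by (rule ex_borel_representative)
  have pl: "p \<in> borel_measurable lebesgue"
    using p(1) by (intro measurable_completion) simp
  have "integrable lebesgue (\<lambda>t. (cmod (p t))\<^sup>2)"
  proof (rule integrable_cong_AE_imp)
    show "integrable lebesgue (\<lambda>t. (cmod (?f t))\<^sup>2)" using f by (simp add: square_integrable_def)
    show "AE t in lebesgue. (cmod (?f t))\<^sup>2 = (cmod (p t))\<^sup>2"
      using p(2) by eventually_elim simp
  qed (use pl in simp)
  with pl have sq: "square_integrable p" by (simp add: square_integrable_def)
  have "\<psi> = abs_L2 p"
    using abs_L2_eqI[OF f sq p(2)] by (simp add: abs_rep_L2)
  with p(1) sq show ?thesis by (rule that)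
qed

lemma borel_measurable_cnj:
  assumes "f \<in> borel_measurable M"
  shows "(\<lambda>x. cnj (f x)) \<in> borel_measurable M"
  using assms by (rule measurable_compose) (intro borel_measurable_continuous_onI continuous_intros)

text \<open>For Borel representatives, the integrand of the inner product is a Borel function of \<open>z\<close> and \<open>t\<close>
  jointly, so Fubini's theorem makes the integral over \<open>t\<close> measurable in \<open>z\<close>.\<close>

lemma borel_measurable_cinner_tf_shift:
  fixes \<psi> \<phi> :: "'a::euclidean_space L2"
  shows "(\<lambda>z. cinner \<psi> (tf_shift z \<phi>)) \<in> borel_measurable borel"
proof -
  obtain p where p: "p \<in> borel_measurable borel" "square_integrable p" "\<psi> = abs_L2 p"
    by (rule ex_borel_L2)
  obtain q where q: "q \<in> borel_measurable borel" "square_integrable q" "\<phi> = abs_L2 q"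
    by (rule ex_borel_L2)
  define k where "k z t = p t * cnj (cis (2 * pi * (snd z \<bullet> t)) * q (t - fst z))" for z :: "'a \<times> 'a" and t
  have "case_prod k \<in> borel_measurable (borel :: (('a \<times> 'a) \<times> 'a) measure)"
  proof -
    have p': "(\<lambda>w::('a \<times> 'a) \<times> 'a. p (snd w)) \<in> borel_measurable borel"
      by (rule measurable_compose[OF _ p(1)]) (intro borel_measurable_continuous_onI continuous_intros)
    have q': "(\<lambda>w::('a \<times> 'a) \<times> 'a. q (snd w - fst (fst w))) \<in> borel_measurable borel"
      by (rule measurable_compose[OF _ q(1)]) (intro borel_measurable_continuous_onI continuous_intros)
    have "(\<lambda>w::('a \<times> 'a) \<times> 'a. cis (2 * pi * (snd (fst w) \<bullet> snd w))) \<in> borel_measurable borel"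
      by (intro borel_measurable_continuous_onI continuous_intros)
    from borel_measurable_times[OF p' borel_measurable_cnj[OF borel_measurable_times[OF this q']]]
    show ?thesis by (simp add: k_def case_prod_unfold)
  qed
  then have k: "case_prod k \<in> borel_measurable (borel \<Otimes>\<^sub>M lborel)"
    by (subst measurable_cong_sets[of _ borel _ borel]) (simp_all add: borel_prod[symmetric] cong: sets_pair_measure_cong)
  have "cinner \<psi> (tf_shift z \<phi>) = (\<integral>t. k z t \<partial>lborel)" for z
  proof -
    have "(\<lambda>t. k z t) \<in> borel_measurable lborel"
      using measurable_Pair2[OF k, of z] by simp
    then have "(\<integral>t. k z t \<partial>lborel) = (\<integral>t. k z t \<partial>lebesgue)"
      by (rule integral_completion[symmetric])
    then show ?thesis
      using p(2) q(2)
      by (cases z) (simp add: p(3) q(3) tf_shift_abs_L2 cinner_abs_L2 square_integrable_shift k_def)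
  qed
  then show ?thesis
    using lborel.borel_measurable_lebesgue_integral[OF k] by simp
qed

text \<open>Expanding \<open>tf_unshift z \<psi>\<close> in the countable orthonormal basis writes the coefficient as a
  countable sum of products of coefficients of \<open>tf_shift z\<close>.\<close>

lemma borel_measurable_cinner_op_translate:
  fixes S :: "'a::euclidean_space L2 \<Rightarrow> 'a L2"
  assumes S: "bounded_op S"
  shows "(\<lambda>z. cinner (op_translate z S \<psi>) \<xi>) \<in> borel_measurable borel"
proof (rule borel_measurable_has_sum)
  show "countable (onb :: 'a L2 set)"
    by (rule countable_onb)
  fix z
  have "((\<lambda>e. cinner (S (scaleC (cinner (tf_unshift z \<psi>) e) e)) (tf_unshift z \<xi>)) has_sum
      cinner (S (tf_unshift z \<psi>)) (tf_unshift z \<xi>)) onb"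
    using S unfolding bounded_op_def
    by (intro has_sum_bounded_linear[OF cinner.bounded_linear_left] has_sum_bounded_linear[of S]
        onb_expansion is_onb_onb) simp
  then show "((\<lambda>e. cnj (cinner e (tf_unshift z \<psi>)) * cinner (S e) (tf_unshift z \<xi>)) has_sum
      cinner (op_translate z S \<psi>) \<xi>) onb"
    using S by (simp add: bounded_op_def cinner_scaleC_left cinner_op_translate
        cinner_commute[of "tf_unshift z \<psi>"])
next
  fix e :: "'a L2"
  have "cinner e (tf_unshift z \<psi>) = cnj (cinner \<psi> (tf_shift z e))" for z
    by (metis cinner_commute cinner_tf_shift_left)
  moreover have "cinner (S e) (tf_unshift z \<xi>) = cnj (cinner \<xi> (tf_shift z (S e)))" for z
    by (metis cinner_commute cinner_tf_shift_left)
  ultimately show "(\<lambda>z. cnj (cinner e (tf_unshift z \<psi>)) * cinner (S e) (tf_unshift z \<xi>)) \<in> borel_measurable borel"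
    using borel_measurable_times[OF borel_measurable_cinner_tf_shift[of \<psi> e]
        borel_measurable_cnj[OF borel_measurable_cinner_tf_shift[of \<xi> "S e"]]]
    by simp
qed

section \<open>The convolution of a function with an operator\<close>

lemma cmod_cinner_op_translate_le:
  assumes "\<And>x. norm (S x) \<le> norm x * K"
  shows "cmod (cinner (op_translate z S \<psi>) \<xi>) \<le> K * norm \<psi> * norm \<xi>"
proof -
  have "cmod (cinner (op_translate z S \<psi>) \<xi>) \<le> norm (S (tf_unshift z \<psi>)) * norm (tf_unshift z \<xi>)"
    unfolding cinner_op_translate by (rule cmod_cinner_le)
  also have "\<dots> \<le> (norm \<psi> * K) * norm \<xi>"
    using assms[of "tf_unshift z \<psi>"] by (simp add: norm_tf_unshift mult_right_mono)
  finally show ?thesis by (simp add: mult_ac)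
qed

text \<open>The weak integral is a bounded sesquilinear form, since the translates of \<open>S\<close> are uniformly
  bounded and \<open>f\<close> is integrable; hence it is represented by exactly one bounded operator, and the
  description in \<open>fun_op_conv\<close> is satisfied.\<close>

lemma fun_op_conv_properties:
  fixes S :: "'a::euclidean_space L2 \<Rightarrow> 'a L2"
  assumes S: "bounded_op S" and f: "integrable lebesgue f"
  shows integrable_cinner_op_translate:
      "\<And>\<psi> \<xi>. integrable lebesgue (\<lambda>z. f z * cinner (op_translate z S \<psi>) \<xi>)"
    and bounded_op_fun_op_conv: "bounded_op (f \<star> S)"
    and cinner_fun_op_conv:
      "\<And>\<psi> \<xi>. cinner ((f \<star> S) \<psi>) \<xi> = (\<integral>z. f z * cinner (op_translate z S \<psi>) \<xi> \<partial>lebesgue)"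
proof -
  interpret S: bounded_linear S using S by (simp add: bounded_op_def)
  have hom: "S (scaleC c x) = scaleC c (S x)" for c x using S by (simp add: bounded_op_def)
  obtain K where K: "K \<ge> 0" "\<And>x. norm (S x) \<le> norm x * K" using S.nonneg_bounded by blast
  define b where "b \<psi> \<xi> = (\<integral>z. f z * cinner (op_translate z S \<psi>) \<xi> \<partial>lebesgue)" for \<psi> \<xi>
  have le: "cmod (f z * cinner (op_translate z S \<psi>) \<xi>) \<le> K * norm \<psi> * norm \<xi> * cmod (f z)" for z \<psi> \<xi>
    using mult_left_mono[OF cmod_cinner_op_translate_le[OF K(2)] norm_ge_zero[of "f z"]]
    by (simp add: norm_mult mult_ac)
  show int: "integrable lebesgue (\<lambda>z. f z * cinner (op_translate z S \<psi>) \<xi>)" for \<psi> \<xi>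
  proof (rule Bochner_Integration.integrable_bound)
    show "integrable lebesgue (\<lambda>z. K * norm \<psi> * norm \<xi> * cmod (f z))"
      using f by simp
    have "(\<lambda>z. cinner (op_translate z S \<psi>) \<xi>) \<in> borel_measurable lebesgue"
      using borel_measurable_cinner_op_translate[OF S] by (intro measurable_completion) simp
    then show "(\<lambda>z. f z * cinner (op_translate z S \<psi>) \<xi>) \<in> borel_measurable lebesgue"
      by (rule borel_measurable_times[OF borel_measurable_integrable[OF f]])
    show "AE z in lebesgue. norm (f z * cinner (op_translate z S \<psi>) \<xi>)
        \<le> norm (K * norm \<psi> * norm \<xi> * cmod (f z))"
      using le K(1) by simp
  qed
  have "\<exists>T. bounded_op T \<and> (\<forall>\<psi> \<xi>. cinner (T \<psi>) \<xi> = b \<psi> \<xi>)"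
  proof (rule bounded_op_of_sesquilinear)
    fix x y z :: "'a L2" and c
    show "b (x + y) z = b x z + b y z"
      unfolding b_def Bochner_Integration.integral_add[OF int int, symmetric]
      by (simp add: cinner_op_translate tf_unshift_add S.add cinner_add_left distrib_left)
    show "b x (y + z) = b x y + b x z"
      unfolding b_def Bochner_Integration.integral_add[OF int int, symmetric]
      by (simp add: cinner_op_translate tf_unshift_add cinner_add_right distrib_left)
    have "b (scaleC c x) y = (\<integral>z. c * (f z * cinner (op_translate z S x) y) \<partial>lebesgue)"
      by (simp add: b_def cinner_op_translate tf_unshift_scaleC hom cinner_scaleC_left mult_ac)
    then show "b (scaleC c x) y = c * b x y"
      by (simp add: b_def)
    have "b x (scaleC c y) = (\<integral>z. cnj c * (f z * cinner (op_translate z S x) y) \<partial>lebesgue)"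
      by (simp add: b_def cinner_op_translate tf_unshift_scaleC cinner_scaleC_right mult_ac)
    then show "b x (scaleC c y) = cnj c * b x y"
      by (simp add: b_def)
    have "cmod (b x y) \<le> (\<integral>z. K * norm x * norm y * cmod (f z) \<partial>lebesgue)"
      unfolding b_def
      by (rule order_trans[OF integral_norm_bound integral_mono])
         (use int f le in \<open>auto intro!: integrable_norm\<close>)
    then show "cmod (b x y) \<le> K * (\<integral>z. cmod (f z) \<partial>lebesgue) * norm x * norm y"
      by (simp add: mult_ac)
  qed
  then obtain T where T: "bounded_op T" "\<And>\<psi> \<xi>. cinner (T \<psi>) \<xi> = b \<psi> \<xi>" by blast
  have "f \<star> S = T"
    unfolding fun_op_conv_def
  proof (rule the_equality)
    show "bounded_op T \<and> (\<forall>\<psi> \<xi>. cinner (T \<psi>) \<xi>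
        = (\<integral>z. f z * cinner (op_translate z S \<psi>) \<xi> \<partial>lebesgue))"
      using T by (simp add: b_def)
    fix T' assume "bounded_op T' \<and> (\<forall>\<psi> \<xi>. cinner (T' \<psi>) \<xi>
        = (\<integral>z. f z * cinner (op_translate z S \<psi>) \<xi> \<partial>lebesgue))"
    then show "T' = T"
      by (intro ext cinner_left_ext) (simp add: T(2) b_def)
  qed
  with T show "bounded_op (f \<star> S)" 
    "cinner ((f \<star> S) \<psi>) \<xi> = (\<integral>z. f z * cinner (op_translate z S \<psi>) \<xi> \<partial>lebesgue)" for \<psi> \<xi>
    by (simp_all add: b_def)
qed

text \<open>Every translate of \<open>S\<close> is positive and has trace \<open>1\<close> in the basis \<open>onb\<close>, because its diagonal
  coefficients are those of \<open>S\<close> in the shifted basis. Both properties survive averaging against \<open>f\<close>.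
  In particular, trace class reduces to the diagonal sum, as \<open>f \<star> S\<close> is its own absolute value.\<close>

lemma density_operator_fun_op_conv:
  fixes S :: "'a::euclidean_space L2 \<Rightarrow> 'a L2"
  assumes S: "density_operator S"
    and f: "integrable lebesgue f"
    and nonneg: "AE z in lebesgue. f z \<in> \<real>\<^sub>\<ge>\<^sub>0"
    and one: "(\<integral>z. f z \<partial>lebesgue) = 1"
  shows "density_operator (f \<star> S)"
proof -
  have pos: "positive_op S" and bdd: "bounded_op S" and tr: "trace_op S = 1"
    using S by (auto simp: density_operator_def positive_op_def)
  have onb: "is_onb (onb :: 'a L2 set)" by (rule is_onb_onb)
  define p where "p z \<psi> = Re (cinner (op_translate z S \<psi>) \<psi>)" for z \<psi>
  have p: "cinner (op_translate z S \<psi>) \<psi> = of_real (p z \<psi>)" "0 \<le> p z \<psi>" for z \<psi>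
    using pos by (auto simp: positive_op_def cinner_op_translate p_def complex_nonneg_Reals_iff complex_eq_iff)
  define g where "g z = Re (f z)" for z
  have fg: "AE z in lebesgue. f z = of_real (g z) \<and> 0 \<le> g z"
    using nonneg by eventually_elim (auto simp: g_def complex_nonneg_Reals_iff complex_eq_iff)
  have g: "integrable lebesgue g" "(\<integral>z. g z \<partial>lebesgue) = 1"
    unfolding g_def using f one by simp_all
  have gp: "integrable lebesgue (\<lambda>z. g z * p z \<psi>)"
    and conv: "cinner ((f \<star> S) \<psi>) \<psi> = of_real (\<integral>z. g z * p z \<psi> \<partial>lebesgue)" for \<psi>
  proof -
    have int: "integrable lebesgue (\<lambda>z. f z * cinner (op_translate z S \<psi>) \<psi>)"
      by (rule integrable_cinner_op_translate[OF bdd f])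
    have "(\<lambda>z. g z * p z \<psi>) = (\<lambda>z. Re (f z * cinner (op_translate z S \<psi>) \<psi>))"
      by (simp add: g_def p(1))
    then show gp: "integrable lebesgue (\<lambda>z. g z * p z \<psi>)"
      using integrable_Re[OF int] by simp
    have "cinner ((f \<star> S) \<psi>) \<psi> = (\<integral>z. complex_of_real (g z * p z \<psi>) \<partial>lebesgue)"
      unfolding cinner_fun_op_conv[OF bdd f]
    proof (rule integral_cong_AE)
      show "AE z in lebesgue. f z * cinner (op_translate z S \<psi>) \<psi> = complex_of_real (g z * p z \<psi>)"
        using fg by eventually_elim (simp add: p(1))
    qed (fact borel_measurable_integrable[OF int] borel_measurable_integrable[OF integrable_of_real[OF gp]])+
    then show "cinner ((f \<star> S) \<psi>) \<psi> = of_real (\<integral>z. g z * p z \<psi> \<partial>lebesgue)"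
      by (simp only: integral_complex_of_real)
  qed
  have gp_nonneg: "AE z in lebesgue. 0 \<le> g z * p z \<psi>" for \<psi>
    using fg by eventually_elim (simp add: p(2))
  then have "0 \<le> (\<integral>z. g z * p z \<psi> \<partial>lebesgue)" for \<psi>
    by (rule integral_nonneg_AE)
  then have posT: "positive_op (f \<star> S)"
    using bounded_op_fun_op_conv[OF bdd f] by (simp add: positive_op_def conv)
  \<comment> \<open>a sum that does not exist has the value \<open>0\<close>, so trace \<open>1\<close> entails summability\<close>
  have "(\<lambda>e. cinner (S e) e) summable_on onb"
    using tr infsum_not_exists[of "\<lambda>e. cinner (S e) e" onb] by (auto simp: trace_op_def)
  then have "((\<lambda>e. cinner (S e) e) has_sum 1) onb"
    using tr by (simp add: trace_op_def has_sum_iff)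
  then have tr1: "((\<lambda>e. Re (cinner (S e) e)) has_sum 1) onb"
    using has_sum_Re by fastforce
  have "((\<lambda>e. p z e) has_sum 1) onb" for z
    using has_sum_reindex[THEN iffD1, OF inj_on_subset[OF inj_tf_unshift[of z] subset_UNIV]
        trace_basis_independent[OF pos onb is_onb_tf_unshift[OF onb, of z] tr1]]
    by (simp add: p_def cinner_op_translate o_def)
  then have sum: "((\<lambda>e. g z * p z e) has_sum g z) onb" for z
    using has_sum_cmult_right[of "p z" onb 1 "g z"] by simp
  have "((\<lambda>e. \<integral>z. g z * p z e \<partial>lebesgue) has_sum (\<integral>z. g z \<partial>lebesgue)) onb"
  proof (rule has_sum_integral_nonneg)
    show "countable (onb :: 'a L2 set)"
      by (rule countable_onb)
  qed (use gp gp_nonneg g(1) sum in auto)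
  then have trT: "((\<lambda>e. cinner ((f \<star> S) e) e) has_sum 1) onb"
    unfolding conv g(2) using has_sum_of_real by fastforce
  show ?thesis
    unfolding density_operator_def trace_class_def trace_op_def
    using posT trT by (auto simp: abs_op_positive_op positive_op_def has_sum_imp_summable infsumI)
qed

theorem lemma7p1:
  fixes S :: "(real ^ 'n) L2 \<Rightarrow> (real ^ 'n) L2"
    and f :: "(real ^ 'n) \<times> (real ^ 'n) \<Rightarrow> complex"
  assumes "density_operator S"
    and "integrable lebesgue f"
    and "AE z in lebesgue. f z \<in> \<real>\<^sub>\<ge>\<^sub>0"
    and "(\<integral>z. f z \<partial>lebesgue) = 1"
  shows "density_operator (f \<star> S)"
  using assms by (rule density_operator_fun_op_conv)

end
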